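(* Let $M_1=(E,\mathcal I_1)$ and $M_2=(E,\mathcal I_2)$ be matroids on a common finite ground set $E$ with ranks $r_1,r_2$, let $w:E\to\mathbb R_{\ge 0}$, fix an arbitrary order of $E$ (the stream), let $\varepsilon>0$, and let $S$ be the final set produced by Algorithm SS (described in the context) with parameters $\alpha=1+\varepsilon$ and $y=\min(r_1,r_2)/\varepsilon^2$. Then there exists a subset $T\subseteq S$ that is independent in both $M_1$ and $M_2$ with $w(T)\ge g(S)$. Moreover, $w(T)\ge w(S^* )/\bigl(2(1+2\varepsilon+o(\varepsilon))\bigr)$, where $S^*$ is a maximum-weight set independent in both $M_1$ and $M_2$; i.e., $T$ is a $2(1+2\varepsilon+o(\varepsilon))$-approximation for weighted matroid intersection.
   Context: For a function $h$ on elements and a finite set $A$, $h(A)=\sum_{a\in A}h(a)$. For a matroid $M$ with rank function $\mathrm{rank}_M$, $\mathrm{span}_M(X)=\{e\in E:\mathrm{rank}_M(X\cup\{e\})=\mathrm{rank}_M(X)\}$. Algorithm SS (parameters $\alpha>1$ and a real $y$): initialize $S=\emptyset$. Elements of $E$ arrive one at a time in the stream order. When $e$ arrives, for $i=1,2$ compute $w_i^*(e)=\max\bigl(\{0\}\cup\{\theta: e\in\mathrm{span}_{M_i}(\{f\in S: w_i(f)\ge\theta\})\}\bigr)$. If $w(e)>\alpha(w_1^*(e)+w_2^*(e))$, then: set $g(e)=w(e)-w_1^*(e)-w_2^*(e)$; add $e$ to $S$; set $w_i(e)=g(e)+w_i^*(e)$ for $i=1,2$; let $T_i$ be a maximum $w_i$-weight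 independent set of $M_i$ among the elements of $S$ ($i=1,2$); let $g_{\max}=\max_{e'\in S}g(e')$; remove from $S$ every $e'\in S$ with $y\cdot g(e')<g_{\max}$ and $e'\notin T_1\cup T_2$. Otherwise $e$ is discarded. $S$ denotes the set at the end of the stream, and $g(S)=\sum_{e\in S}g(e)$. $o(\varepsilon)$ denotes a quantity depending only on $\varepsilon$ with $o(\varepsilon)/\varepsilon\to0$ as $\varepsilon\to0$. *)

theory Defs
  imports Complex_Main "HOL-Library.Extended_Real" "HOL-Library.Landau_Symbols"
begin

locale matroid =
  fixes E :: "'a set" and \<I> :: "'a set set"
  assumes finite_ground: "finite E"
    and indep_subset_ground: "X \<in> \<I> \<Longrightarrow> X \<subseteq> E"
    and indep_empty: "{} \<in> \<I>"
    and indep_subset: "\<lbrakk>X \<in> \<I>; Y \<subseteq> X\<rbrakk> \<Longrightarrow> Y \<in> \<I>"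
    and augment: "\<lbrakk>X \<in> \<I>; Y \<in> \<I>; card X < card Y\<rbrakk> \<Longrightarrow> \<exists>e\<in>Y - X. insert e X \<in> \<I>"

definition mrank :: "'a set set \<Rightarrow> 'a set \<Rightarrow> nat" where
  "mrank \<I> X = Max (card ` {Y \<in> \<I>. Y \<subseteq> X})"

definition mspan :: "'a set \<Rightarrow> 'a set set \<Rightarrow> 'a set \<Rightarrow> 'a set" where
  "mspan E \<I> X = {e \<in> E. mrank \<I> (X \<union> {e}) = mrank \<I> X}"

text \<open>
  The threshold weight \<open>w\<^sub>i\<^sup>*(e)\<close>. Unless \<open>e\<close> is a loop, the supremum is a maximum and is
  finite. A loop lies in the span of every set, so all real \<open>\<theta>\<close> qualify and the value is
  \<open>\<infinity>\<close>; loops are therefore always discarded by the algorithm below.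
\<close>

definition wstar ::
  "'a set \<Rightarrow> 'a set set \<Rightarrow> 'a set \<Rightarrow> ('a \<Rightarrow> real) \<Rightarrow> 'a \<Rightarrow> ereal" where
  "wstar E \<I> S h e = Sup ({0} \<union> ereal ` {\<theta>. e \<in> mspan E \<I> {f \<in> S. h f \<ge> \<theta>}})"

text \<open>
  The values of \<open>gain\<close>, \<open>wt1\<close> and \<open>wt2\<close> are only meaningful on elements that have been
  added to \<open>stored\<close>.
\<close>

record 'a ss_state =
  stored :: "'a set"
  gain :: "'a \<Rightarrow> real"
  wt1 :: "'a \<Rightarrow> real"
  wt2 :: "'a \<Rightarrow> real"

definition ss_init :: "'a ss_state" where
  "ss_init = \<lparr>stored = {}, gain = (\<lambda>_. 0), wt1 = (\<lambda>_. 0), wt2 = (\<lambda>_. 0)\<rparr>"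

text \<open>
  Processing one element. This is a relation rather than a function because the
  maximum-weight independent sets \<open>T1\<close> and \<open>T2\<close> need not be unique; any choice is allowed.
  When \<open>keep\<close> applies, both threshold weights are finite, so \<open>real_of_ereal\<close> loses nothing.
\<close>

inductive ss_step ::
  "'a set \<Rightarrow> 'a set set \<Rightarrow> 'a set set \<Rightarrow> ('a \<Rightarrow> real) \<Rightarrow> real \<Rightarrow> real
    \<Rightarrow> 'a \<Rightarrow> 'a ss_state \<Rightarrow> 'a ss_state \<Rightarrow> bool"
  for E \<I>1 \<I>2 w \<alpha> y
  where
    keep: "\<lbrakk> s1 = wstar E \<I>1 (stored \<sigma>) (wt1 \<sigma>) e;
             s2 = wstar E \<I>2 (stored \<sigma>) (wt2 \<sigma>) e;
             ereal (w e) > ereal \<alpha> * (s1 + s2);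
             ge = w e - real_of_ereal s1 - real_of_ereal s2;
             S = insert e (stored \<sigma>);
             g = (gain \<sigma>)(e := ge);
             w1 = (wt1 \<sigma>)(e := ge + real_of_ereal s1);
             w2 = (wt2 \<sigma>)(e := ge + real_of_ereal s2);
             is_arg_max (sum w1) (\<lambda>X. X \<in> \<I>1 \<and> X \<subseteq> S) T1;
             is_arg_max (sum w2) (\<lambda>X. X \<in> \<I>2 \<and> X \<subseteq> S) T2;
             gmax = Max (g ` S);
             S' = S - {e' \<in> S. y * g e' < gmax \<and> e' \<notin> T1 \<union> T2} \<rbrakk>
           \<Longrightarrow> ss_step E \<I>1 \<I>2 w \<alpha> y e \<sigma> \<lparr>stored = S', gain = g, wt1 = w1, wt2 = w2\<rparr>"
  | discard: "\<lbrakk> s1 = wstar E \<I>1 (stored \<sigma>) (wt1 \<sigma>) e;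
                s2 = wstar E \<I>2 (stored \<sigma>) (wt2 \<sigma>) e;
                \<not> ereal (w e) > ereal \<alpha> * (s1 + s2) \<rbrakk>
              \<Longrightarrow> ss_step E \<I>1 \<I>2 w \<alpha> y e \<sigma> \<sigma>"

inductive ss_run ::
  "'a set \<Rightarrow> 'a set set \<Rightarrow> 'a set set \<Rightarrow> ('a \<Rightarrow> real) \<Rightarrow> real \<Rightarrow> real
    \<Rightarrow> 'a list \<Rightarrow> 'a ss_state \<Rightarrow> 'a ss_state \<Rightarrow> bool"
  for E \<I>1 \<I>2 w \<alpha> y
  where
    Nil: "ss_run E \<I>1 \<I>2 w \<alpha> y [] \<sigma> \<sigma>"
  | Cons: "\<lbrakk> ss_step E \<I>1 \<I>2 w \<alpha> y e \<sigma> \<sigma>'; ss_run E \<I>1 \<I>2 w \<alpha> y es \<sigma>' \<sigma>'' \<rbrakk>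
           \<Longrightarrow> ss_run E \<I>1 \<I>2 w \<alpha> y (e # es) \<sigma> \<sigma>''"

definition ss_result ::
  "'a set \<Rightarrow> 'a set set \<Rightarrow> 'a set set \<Rightarrow> ('a \<Rightarrow> real) \<Rightarrow> real \<Rightarrow> real
    \<Rightarrow> 'a list \<Rightarrow> 'a ss_state \<Rightarrow> bool" where
  "ss_result E \<I>1 \<I>2 w \<alpha> y es \<sigma> \<longleftrightarrow> ss_run E \<I>1 \<I>2 w \<alpha> y es ss_init \<sigma>"

end

theory Submission
  imports Defs
begin

text \<open>
  Elements removed by the algorithm lie outside \<open>T\<^sub>1 \<union> T\<^sub>2\<close>, so the spans
  of the level sets \<open>{f \<in> S. w\<^sub>i(f) \<ge> \<theta>}\<close>, and hence all later thresholds, are the same as for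
  the set \<open>A\<close> of all elements ever kept. Keeping \<open>e\<close> raises the maximum weight
  of an \<open>M\<^sub>i\<close>-independent subset by exactly \<open>g(e)\<close>; this maximum is therefore \<open>g(A)\<close> on \<open>A\<close>, and by
  monotonicity of thresholds at least \<open>g(X)\<close> on any \<open>X \<subseteq> A\<close>.

  For the lower bound on \<open>w(T)\<close>, let \<open>T\<close> be a matroid kernel of \<open>S\<close>: it is independent in both
  matroids and every \<open>e \<in> S\<close> lies in the \<open>M\<^sub>i\<close>-span of \<open>{f \<in> T. w\<^sub>i(f) \<ge> w\<^sub>i(e)}\<close> for some \<open>i\<close>. If \<open>D\<^sub>i\<close>
  denotes the elements spanned in this way, then \<open>w\<^sub>i(T) \<ge> g(D\<^sub>i)\<close>, and
  \<open>w(T) = w\<^sub>1(T) + w\<^sub>2(T) - g(T) \<ge> g(D\<^sub>1 \<union> D\<^sub>2) = g(S)\<close>.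

  For the approximation ratio, every non-loop satisfies \<open>w(e) \<le> (1 + \<epsilon>) (w\<^sub>1\<^sup>*(e) + w\<^sub>2\<^sup>*(e))\<close> with
  respect to the final \<open>A\<close>, so \<open>w(S\<^sup>*) \<le> 2 (1 + \<epsilon>) g(A)\<close>. Finally \<open>w\<^sub>i(e) \<le> (1 + 1/\<epsilon>) g(e)\<close> on \<open>A\<close>
  makes the removed elements cheap: \<open>g(A) \<le> (1 + \<epsilon> + \<epsilon>\<^sup>2) g(S)\<close>.
\<close>

section \<open>Comparing sums by the sizes of level sets; keys that break ties\<close>

text \<open>A discrete layer-cake argument: remove a maximal element from each side. Level sets with
  \<open>\<theta> \<le> f x\<close> lose one element on both sides, and above \<open>f x\<close> the
  left level sets are empty.\<close>

lemma sum_le_sum_of_level_card_le: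
  fixes f :: "'a \<Rightarrow> real" and g :: "'b \<Rightarrow> real"
  assumes "finite X" "finite Y" "\<And>y. y \<in> Y \<Longrightarrow> 0 \<le> g y"
    and "\<And>\<theta>. 0 < \<theta> \<Longrightarrow> card {x \<in> X. \<theta> \<le> f x} \<le> card {y \<in> Y. \<theta> \<le> g y}"
  shows "sum f X \<le> sum g Y"
  using assms
proof (induction "card X" arbitrary: X Y)
  case 0
  then show ?case by (simp add: sum_nonneg)
next
  case (Suc n)
  then have "X \<noteq> {}" by auto
  then obtain x where x: "x \<in> X" "\<And>x'. x' \<in> X \<Longrightarrow> f x' \<le> f x"
    using Suc.prems(1) obtains_MAX by (metis Max_ge finite_imageI imageI)
  show ?case
  proof (cases "f x > 0")
    case False
    then have "sum f X \<le> 0" using x(2) by (meson linorder_not_less order_trans sum_nonpos)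
    also have "0 \<le> sum g Y" using Suc.prems(3) by (simp add: sum_nonneg)
    finally show ?thesis .
  next
    case True
    have "card {x' \<in> X. f x \<le> f x'} > 0" using x Suc.prems(1) by (auto simp: card_gt_0_iff)
    then have "card {y \<in> Y. f x \<le> g y} > 0" using Suc.prems(4)[OF True] by linarith
    then have "Y \<noteq> {}" "\<exists>y\<in>Y. f x \<le> g y" by (force simp: card_gt_0_iff)+
    then obtain y where y: "y \<in> Y" "\<And>y'. y' \<in> Y \<Longrightarrow> g y' \<le> g y"
      using Suc.prems(2) obtains_MAX by (metis Max_ge finite_imageI imageI)
    have fg: "f x \<le> g y" using \<open>\<exists>y\<in>Y. f x \<le> g y\<close> y(2) by force
    have "sum f (X - {x}) \<le> sum g (Y - {y})"
    proof (rule Suc.hyps(1))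
      show "n = card (X - {x})" using Suc.hyps(2) x(1) Suc.prems(1) by simp
      show "card {x' \<in> X - {x}. \<theta> \<le> f x'} \<le> card {y' \<in> Y - {y}. \<theta> \<le> g y'}" if "0 < \<theta>" for \<theta>
      proof (cases "\<theta> \<le> f x")
        case True
        have "{x' \<in> X - {x}. \<theta> \<le> f x'} = {x' \<in> X. \<theta> \<le> f x'} - {x}"
          "{y' \<in> Y - {y}. \<theta> \<le> g y'} = {y' \<in> Y. \<theta> \<le> g y'} - {y}" by auto
        then show ?thesis using Suc.prems(4)[OF that] x(1) y(1) True fg by (simp add: card_Diff_singleton)
      next
        case False
        then have "{x' \<in> X - {x}. \<theta> \<le> f x'} = {}" using x(2) by force
        then show ?thesis by (simp only: card.empty)
      qed
    qed (use Suc.prems in auto)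
    then show ?thesis
      using x(1) y(1) fg Suc.prems(1,2) by (simp add: sum.remove[of X x] sum.remove[of Y y])
  qed
qed

lemma sum_eq_sum_of_level_card_eq:
  fixes f :: "'a \<Rightarrow> real" and g :: "'b \<Rightarrow> real"
  assumes "finite X" "finite Y" "\<And>x. x \<in> X \<Longrightarrow> 0 \<le> f x" "\<And>y. y \<in> Y \<Longrightarrow> 0 \<le> g y"
    and "\<And>\<theta>. 0 < \<theta> \<Longrightarrow> card {x \<in> X. \<theta> \<le> f x} = card {y \<in> Y. \<theta> \<le> g y}"
  shows "sum f X = sum g Y"
  using assms by (intro antisym sum_le_sum_of_level_card_le) auto

text \<open>The key is the position in a list of \<open>S\<close> sorted by
  \<open>h\<close>.\<close>

lemma inj_key_refining:
  fixes h :: "'a \<Rightarrow> 'b :: linorder"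
  assumes "finite S"
  obtains k :: "'a \<Rightarrow> nat"
  where "inj_on k S" "\<And>x y. x \<in> S \<Longrightarrow> y \<in> S \<Longrightarrow> k x < k y \<Longrightarrow> h x \<le> h y"
proof -
  obtain xs where xs: "set xs = S" "distinct xs" using finite_distinct_list[OF assms] by blast
  define ys where "ys = sort_key h xs"
  have ys: "set ys = S" "distinct ys" "sorted (map h ys)" using xs by (auto simp: ys_def)
  define k where "k x = (SOME i. i < length ys \<and> ys ! i = x)" for x
  have k: "k x < length ys \<and> ys ! k x = x" if "x \<in> S" for x
    unfolding k_def by (rule someI_ex) (use that ys(1) in \<open>auto simp: in_set_conv_nth\<close>)
  show thesis
  proof
    show "inj_on k S" using k by (metis inj_onI)
    show "h x \<le> h y" if "x \<in> S" "y \<in> S" "k x < k y" for x y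
      using sorted_nth_mono[OF ys(3), of "k x" "k y"] that k by force
  qed
qed

section \<open>Rank and span in a matroid\<close>

context matroid
begin

abbreviation rk :: "'a set \<Rightarrow> nat" where "rk \<equiv> mrank \<I>"
abbreviation cl :: "'a set \<Rightarrow> 'a set" where "cl \<equiv> mspan E \<I>"

lemma finite_indep: "X \<in> \<I> \<Longrightarrow> finite X"
  using finite_ground finite_subset indep_subset_ground by blast

lemma finite_card_indep: "finite (card ` {Y \<in> \<I>. Y \<subseteq> X})"
proof -
  have "{Y \<in> \<I>. Y \<subseteq> X} \<subseteq> Pow E" using indep_subset_ground by auto
  then show ?thesis using finite_ground by (meson finite_Pow_iff finite_imageI finite_subset)
qed

lemma card_le_rk: "Y \<in> \<I> \<Longrightarrow> Y \<subseteq> X \<Longrightarrow> card Y \<le> rk X"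
  unfolding mrank_def using finite_card_indep by (intro Max_ge) auto

lemma rk_attained: obtains B where "B \<in> \<I>" "B \<subseteq> X" "card B = rk X"
proof -
  have "rk X \<in> card ` {Y \<in> \<I>. Y \<subseteq> X}"
    unfolding mrank_def using finite_card_indep indep_empty by (intro Max_in) auto
  then show thesis using that by auto
qed

lemma rk_mono: "X \<subseteq> Y \<Longrightarrow> rk X \<le> rk Y"
  by (metis card_le_rk order_trans rk_attained)

lemma indep_extend_card:
  assumes "X \<in> \<I>" "Y \<in> \<I>" "card X \<le> card Y"
  obtains B where "B \<in> \<I>" "X \<subseteq> B" "B \<subseteq> X \<union> Y" "card B = card Y"
  using assms
proof (induction "card Y - card X" arbitrary: X thesis)
  case 0
  then show ?case by auto
next
  case (Suc n)
  have "card X < card Y" using Suc.hyps(2) by simp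
  then obtain e where e: "e \<in> Y - X" "insert e X \<in> \<I>" using augment[of X Y] Suc.prems(2,3) by blast
  then have c: "card (insert e X) = Suc (card X)" using finite_indep Suc.prems(2) by simp
  show ?case
    by (rule Suc.hyps(1)[of "insert e X"]) (use Suc c e in \<open>auto simp: insert_absorb\<close>)
qed

lemma indep_extend_basis:
  assumes "Y \<in> \<I>" "Y \<subseteq> X"
  obtains B where "B \<in> \<I>" "Y \<subseteq> B" "B \<subseteq> X" "card B = rk X"
proof -
  obtain C where "C \<in> \<I>" "C \<subseteq> X" "card C = rk X" by (rule rk_attained)
  then show thesis
    using indep_extend_card[of Y C] assms that by (metis card_le_rk le_sup_iff order_trans)
qed

lemma rk_indep: "X \<in> \<I> \<Longrightarrow> rk X = card X"
  by (metis card_le_rk card_mono finite_indep order_antisym order_refl rk_attained)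

lemma rk_insert:
  assumes "e \<in> E"
  shows "rk (insert e X) = (if e \<in> cl X then rk X else Suc (rk X))"
proof -
  have "rk (insert e X) \<le> Suc (rk X)"
  proof -
    obtain B where B: "B \<in> \<I>" "B \<subseteq> insert e X" "card B = rk (insert e X)" by (rule rk_attained)
    then have "card (B - {e}) \<le> rk X" by (intro card_le_rk) (auto intro: indep_subset)
    then show ?thesis using B(3) by (simp add: card_Diff_singleton_if split: if_splits)
  qed
  moreover have "rk X \<le> rk (insert e X)" by (rule rk_mono) auto
  ultimately show ?thesis using assms by (auto simp: mspan_def)
qed

text \<open>Any single basis \<open>B\<close> of \<open>X\<close> decides membership in the span:
  augmenting \<open>B\<close> from a larger independent subset of \<open>insert e X\<close> must add
  \<open>e\<close>, since adding an element of \<open>X\<close> would exceed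
  \<open>rk X\<close>.\<close>

lemma mem_cl_iff_basis:
  assumes "B \<in> \<I>" "B \<subseteq> X" "card B = rk X" "e \<in> E"
  shows "e \<in> cl X \<longleftrightarrow> e \<in> B \<or> insert e B \<notin> \<I>"
proof
  assume "e \<in> cl X"
  then have *: "rk (insert e X) = rk X" using rk_insert assms(4) by simp
  show "e \<in> B \<or> insert e B \<notin> \<I>"
  proof (rule ccontr)
    assume "\<not> ?thesis"
    then have "card (insert e B) \<le> rk (insert e X)" "card (insert e B) = Suc (card B)"
      using assms finite_indep card_le_rk[of "insert e B" "insert e X"] by auto
    then show False using * assms by simp
  qed
next
  assume a: "e \<in> B \<or> insert e B \<notin> \<I>"
  show "e \<in> cl X"
  proof (rule ccontr)
    assume "e \<notin> cl X"
    then have "card B < rk (insert e X)" using rk_insert assms by simp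
    moreover obtain C where C: "C \<in> \<I>" "C \<subseteq> insert e X" "card C = rk (insert e X)"
      by (rule rk_attained)
    ultimately obtain x where x: "x \<in> C - B" "insert x B \<in> \<I>" using augment assms by metis
    then have "x \<noteq> e" using a by auto
    then have "card (insert x B) \<le> rk X" using x C assms by (intro card_le_rk) auto
    then show False using x assms finite_indep by simp
  qed
qed

lemma cl_ground: "cl X \<subseteq> E" by (auto simp: mspan_def)

lemma cl_superset: "X \<subseteq> E \<Longrightarrow> X \<subseteq> cl X" by (auto simp: mspan_def insert_absorb)

lemma cl_mono: assumes "X \<subseteq> Y" shows "cl X \<subseteq> cl Y"
proof
  fix e assume e: "e \<in> cl X"
  then have "e \<in> E" using cl_ground by auto
  obtain B where B: "B \<in> \<I>" "B \<subseteq> X" "card B = rk X" by (rule rk_attained)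
  obtain C where C: "C \<in> \<I>" "B \<subseteq> C" "C \<subseteq> Y" "card C = rk Y"
    using indep_extend_basis B assms by (metis order_trans)
  show "e \<in> cl Y"
    using e mem_cl_iff_basis[OF B \<open>e \<in> E\<close>] mem_cl_iff_basis[OF C(1,3,4) \<open>e \<in> E\<close>] C(2)
    by (meson indep_subset insert_mono subsetD)
qed

lemma rk_Un_cl: assumes "X \<subseteq> cl Y" shows "rk (Y \<union> X) = rk Y"
proof (rule ccontr)
  assume "rk (Y \<union> X) \<noteq> rk Y"
  then have lt: "rk Y < rk (Y \<union> X)" using rk_mono[of Y "Y \<union> X"] by simp
  obtain B where B: "B \<in> \<I>" "B \<subseteq> Y" "card B = rk Y" by (rule rk_attained)
  obtain C where C: "C \<in> \<I>" "C \<subseteq> Y \<union> X" "card C = rk (Y \<union> X)" by (rule rk_attained)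
  obtain x where x: "x \<in> C - B" "insert x B \<in> \<I>" using augment[OF B(1) C(1)] lt B C by auto
  then have "x \<in> E" using indep_subset_ground by auto
  then have "x \<notin> cl Y" using mem_cl_iff_basis[OF B] x by auto
  then have "x \<in> Y" using x C assms by auto
  then have "insert x B \<subseteq> Y" using B by auto
  then have "card (insert x B) \<le> rk Y" using x card_le_rk by blast
  then show False using x B finite_indep by simp
qed

lemma cl_subset_cl: assumes "X \<subseteq> cl Y" shows "cl X \<subseteq> cl Y"
proof
  fix e assume "e \<in> cl X"
  then have e: "e \<in> cl (Y \<union> X)" "e \<in> E" using cl_mono[of X "Y \<union> X"] cl_ground by auto
  then have "rk (insert e (Y \<union> X)) = rk Y" using rk_insert rk_Un_cl[OF assms] by simp
  then have "rk (insert e Y) \<le> rk Y" using rk_mono[of "insert e Y" "insert e (Y \<union> X)"] by auto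
  then show "e \<in> cl Y" using rk_insert[OF e(2), of Y] e by (auto split: if_splits)
qed

lemma rk_le_of_subset_cl: "X \<subseteq> cl Y \<Longrightarrow> rk X \<le> rk Y"
  by (metis rk_Un_cl rk_mono sup_ge2)

lemma insert_indep_iff: "X \<in> \<I> \<Longrightarrow> e \<in> E \<Longrightarrow> e \<notin> cl X \<Longrightarrow> insert e X \<in> \<I>"
  using mem_cl_iff_basis[of X X e] rk_indep by auto

lemma indep_not_loop: "X \<in> \<I> \<Longrightarrow> e \<in> X \<Longrightarrow> e \<notin> cl {}"
  using mem_cl_iff_basis[of "{}" "{}" e] rk_indep[OF indep_empty] indep_empty
    indep_subset[of X "{e}"] indep_subset_ground by auto

section \<open>Domination, thresholds and optimal bases\<close>

text \<open>Equivalent to the inclusion of each level set of \<open>X\<close> in the span of the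
  level set of \<open>T\<close> at the same height.\<close>

definition dominates :: "('a \<Rightarrow> real) \<Rightarrow> 'a set \<Rightarrow> 'a set \<Rightarrow> bool" where
  "dominates h T X \<longleftrightarrow> (\<forall>e\<in>X. e \<in> cl {f \<in> T. h e \<le> h f})"

text \<open>For positive \<open>h\<close> and \<open>X \<subseteq> E\<close> these are the
  independent subsets of \<open>X\<close> of maximum weight; this form without sums gives the rank
  of every level set.\<close>

definition opt_basis :: "('a \<Rightarrow> real) \<Rightarrow> 'a set \<Rightarrow> 'a set \<Rightarrow> bool" where
  "opt_basis h X T \<longleftrightarrow> T \<in> \<I> \<and> T \<subseteq> X \<and> dominates h T X"

text \<open>The real-valued form of \<open>wstar\<close>. Only positive levels are tested because
  \<open>wstar\<close> includes 0 anyway; for a loop no \<open>t\<close> qualifies.\<close>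

definition threshold :: "('a \<Rightarrow> real) \<Rightarrow> 'a set \<Rightarrow> 'a \<Rightarrow> real \<Rightarrow> bool" where
  "threshold h S e t \<longleftrightarrow> 0 \<le> t \<and> (\<forall>\<theta>>0. e \<in> cl {f \<in> S. \<theta> \<le> h f} \<longleftrightarrow> \<theta> \<le> t)"

lemma dominates_level:
  assumes "dominates h T X"
  shows "{f \<in> X. \<theta> \<le> h f} \<subseteq> cl {f \<in> T. \<theta> \<le> h f}"
proof
  fix e assume e: "e \<in> {f \<in> X. \<theta> \<le> h f}"
  then have "e \<in> cl {f \<in> T. h e \<le> h f}" using assms by (auto simp: dominates_def)
  also have "\<dots> \<subseteq> cl {f \<in> T. \<theta> \<le> h f}" using e by (intro cl_mono) auto
  finally show "e \<in> cl {f \<in> T. \<theta> \<le> h f}" .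
qed

lemma dominates_superset: "X \<subseteq> T \<Longrightarrow> T \<subseteq> E \<Longrightarrow> dominates h T X"
  unfolding dominates_def using cl_superset[of "{f \<in> T. h e \<le> h f}" for e] by fastforce

lemma dominates_trans: "dominates h T S \<Longrightarrow> dominates h S X \<Longrightarrow> dominates h T X"
  using cl_subset_cl[OF dominates_level] unfolding dominates_def[of h S] dominates_def[of h T X] by blast

lemma dominates_mono: "dominates h T X \<Longrightarrow> T \<subseteq> T' \<Longrightarrow> dominates h T' X"
  unfolding dominates_def using cl_mono[of "{f \<in> T. h e \<le> h f}" "{f \<in> T'. h e \<le> h f}" for e]
  by blast

lemma dominates_cong:
  assumes "\<And>f. f \<in> T \<union> X \<Longrightarrow> h f = h' f" shows "dominates h T X \<longleftrightarrow> dominates h' T X"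
proof -
  have "{f \<in> T. h e \<le> h f} = {f \<in> T. h' e \<le> h' f}" if "e \<in> X" for e
    using that assms by auto
  then show ?thesis by (simp add: dominates_def)
qed

lemma opt_basis_cong:
  "(\<And>f. f \<in> X \<Longrightarrow> h f = h' f) \<Longrightarrow> opt_basis h X T \<longleftrightarrow> opt_basis h' X T"
  unfolding opt_basis_def using dominates_cong[of T X h h'] by blast

lemma threshold_cong:
  assumes "\<And>f. f \<in> S \<Longrightarrow> h f = h' f" shows "threshold h S e t \<longleftrightarrow> threshold h' S e t"
proof -
  have "{f \<in> S. \<theta> \<le> h f} = {f \<in> S. \<theta> \<le> h' f}" for \<theta>
    using assms by auto
  then show ?thesis by (simp add: threshold_def)
qed

lemma opt_basis_card_level:
  assumes "opt_basis h X T" shows "card {f \<in> T. \<theta> \<le> h f} = rk {f \<in> X. \<theta> \<le> h f}"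
proof -
  have "{f \<in> T. \<theta> \<le> h f} \<in> \<I>" using assms by (auto simp: opt_basis_def intro: indep_subset)
  then have "card {f \<in> T. \<theta> \<le> h f} = rk {f \<in> T. \<theta> \<le> h f}" by (simp add: rk_indep)
  also have "\<dots> = rk {f \<in> X. \<theta> \<le> h f}"
    using assms by (intro antisym rk_mono rk_le_of_subset_cl dominates_level)
      (auto simp: opt_basis_def)
  finally show ?thesis .
qed

lemma threshold_mono:
  assumes "threshold h S e t" "threshold h S' e t'" "dominates h S' S"
  shows "t \<le> t'"
proof (cases "0 < t")
  case True
  then have "e \<in> cl {f \<in> S. t \<le> h f}" using assms(1) by (simp add: threshold_def)
  then have "e \<in> cl {f \<in> S'. t \<le> h f}" using cl_subset_cl[OF dominates_level[OF assms(3)]] by blast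
  then show ?thesis using True assms(2) by (simp add: threshold_def)
next
  case False
  then show ?thesis using assms(2) by (simp add: threshold_def)
qed

lemma threshold_transfer:
  assumes "threshold h S e t" "dominates h S' S" "dominates h S S'"
  shows "threshold h S' e t"
  using assms(1) cl_subset_cl[OF dominates_level[OF assms(2)]]
    cl_subset_cl[OF dominates_level[OF assms(3)]]
  unfolding threshold_def by blast

text \<open>Level sets change only at values of \<open>h\<close>, so the threshold is the largest
  positive value whose level set spans \<open>e\<close>, or 0 if there is none. For a non-loop,
  spanning level sets are nonempty.\<close>

lemma threshold_exists:
  assumes "finite S" "e \<notin> cl {}" shows "\<exists>t. threshold h S e t"
proof -
  define V where "V = {v \<in> h ` S. 0 < v \<and> e \<in> cl {f \<in> S. v \<le> h f}}"
  have fin: "finite V" using assms by (simp add: V_def)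
  have V: "\<exists>v\<in>V. \<theta> \<le> v" if "0 < \<theta>" "e \<in> cl {f \<in> S. \<theta> \<le> h f}" for \<theta>
  proof -
    let ?L = "{f \<in> S. \<theta> \<le> h f}"
    have ne: "?L \<noteq> {}" using that(2) assms(2) by (metis (no_types, lifting))
    define v where "v = Min (h ` ?L)"
    have "v \<in> h ` ?L" unfolding v_def by (rule Min_in) (use ne assms(1) in auto)
    moreover have "v \<le> h f" if "f \<in> ?L" for f
      unfolding v_def by (rule Min_le) (use that assms(1) in auto)
    ultimately have "\<theta> \<le> v" "?L = {f \<in> S. v \<le> h f}" "v \<in> h ` S" by fastforce+
    then show ?thesis using that unfolding V_def by (intro bexI[of _ v]) auto
  qed
  define t where "t = (if V = {} then 0 else Max V)"
  have tV: "V \<noteq> {} \<Longrightarrow> t \<in> V" using fin by (simp add: t_def)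
  have "threshold h S e t"
    unfolding threshold_def
  proof (intro conjI allI impI iffI)
    show "0 \<le> t" using tV by (cases "V = {}") (auto simp: t_def V_def)
    show "\<theta> \<le> t" if *: "0 < \<theta>" "e \<in> cl {f \<in> S. \<theta> \<le> h f}" for \<theta>
    proof -
      obtain v where "v \<in> V" "\<theta> \<le> v" using V[OF *] by blast
      then show ?thesis using Max_ge[OF fin, of v] by (auto simp: t_def)
    qed
    show "e \<in> cl {f \<in> S. \<theta> \<le> h f}" if "0 < \<theta>" "\<theta> \<le> t" for \<theta>
    proof -
      have "V \<noteq> {}" using that by (auto simp: t_def)
      then have "e \<in> cl {f \<in> S. t \<le> h f}" using tV by (auto simp: V_def)
      then show ?thesis using cl_mono[of "{f \<in> S. t \<le> h f}" "{f \<in> S. \<theta> \<le> h f}"] that by force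
    qed
  qed
  then show ?thesis ..
qed

lemma wstar_threshold:
  assumes "threshold h S e t" shows "wstar E \<I> S h e = ereal t"
  unfolding wstar_def
proof (rule Sup_eqI)
  fix x assume "x \<in> {0} \<union> ereal ` {\<theta>. e \<in> cl {f \<in> S. \<theta> \<le> h f}}"
  then consider "x = 0" | \<theta> where "x = ereal \<theta>" "e \<in> cl {f \<in> S. \<theta> \<le> h f}" by auto
  then show "x \<le> ereal t"
  proof cases
    case 1
    then show ?thesis using assms by (simp add: threshold_def)
  next
    case 2
    then show ?thesis using assms by (cases "0 < \<theta>") (auto simp: threshold_def)
  qed
next
  fix x :: ereal assume *: "\<And>z. z \<in> {0} \<union> ereal ` {\<theta>. e \<in> cl {f \<in> S. \<theta> \<le> h f}} \<Longrightarrow> z \<le> x"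
  show "ereal t \<le> x"
  proof (cases "0 < t")
    case True
    then show ?thesis using assms by (intro *) (auto simp: threshold_def)
  next
    case False
    then have "ereal t = 0" using assms by (auto simp: threshold_def zero_ereal_def)
    then show ?thesis using * by simp
  qed
qed

lemma wstar_loop:
  assumes "e \<in> cl {}" shows "wstar E \<I> S h e = \<infinity>"
proof -
  have "e \<in> cl {f \<in> S. \<theta> \<le> h f}" for \<theta> using assms cl_mono[of "{}"] by blast
  then have "ereal \<theta> \<le> wstar E \<I> S h e" for \<theta>
    unfolding wstar_def by (intro Sup_upper) auto
  then show ?thesis using ereal_top by blast
qed

lemma threshold_self:
  assumes "threshold h S e t" "e \<in> S" "S \<subseteq> E" shows "h e \<le> t"
proof (cases "0 < h e")
  case True
  have "e \<in> cl {f \<in> S. h e \<le> h f}" using cl_superset[of "{f \<in> S. h e \<le> h f}"] assms by auto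
  then show ?thesis using True assms(1) by (simp add: threshold_def)
next
  case False
  then show ?thesis using assms(1) by (simp add: threshold_def)
qed

text \<open>The greedy algorithm, with ties of \<open>h\<close> broken by an injective key \<open>k\<close>: an element is
  rejected iff it is spanned by elements with a larger key.\<close>

definition rejected :: "('a \<Rightarrow> nat) \<Rightarrow> 'a set \<Rightarrow> 'a set" where
  "rejected k X = {e \<in> X. e \<in> cl {f \<in> X. k e < k f}}"

lemma rejected_mono: assumes "X \<subseteq> Y" shows "rejected k X \<subseteq> rejected k Y"
proof -
  have "cl {f \<in> X. k e < k f} \<subseteq> cl {f \<in> Y. k e < k f}" for e
    using assms by (intro cl_mono) auto
  then show ?thesis using assms unfolding rejected_def by blast
qed

text \<open>Among accepted elements, the one with the smallest key is not spanned by the others,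
  whose keys are larger. The induction runs over all subsets \<open>Z\<close> so that this element
  can be split off.\<close>

lemma greedy_indep:
  assumes "finite X" "X \<subseteq> E" "inj_on k X"
  shows "X - rejected k X \<in> \<I>"
proof -
  have "Z \<in> \<I>" if "Z \<subseteq> X - rejected k X" for Z
    using that
  proof (induction "card Z" arbitrary: Z)
    case 0
    then show ?case using assms(1) indep_empty by (metis card_0_eq finite_Diff finite_subset)
  next
    case (Suc n)
    then have Z: "finite Z" "Z \<noteq> {}" using card.infinite by fastforce+
    then obtain e where e: "e \<in> Z" "\<And>f. f \<in> Z \<Longrightarrow> k e \<le> k f"
      using ex_min_if_finite[of "k ` Z"] by (metis (no_types, lifting) arg_min_if_finite(1) arg_min_least)
    have I: "Z - {e} \<in> \<I>" using Suc e Z by (intro Suc.hyps) auto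
    have "k e < k f" if "f \<in> Z - {e}" for f
      using that e Suc.prems inj_onD[OF assms(3), of e f] by (metis DiffE le_neq_implies_less singletonI subsetD)
    then have "cl (Z - {e}) \<subseteq> cl {f \<in> X. k e < k f}" using Suc.prems by (intro cl_mono) auto
    then have "e \<notin> cl (Z - {e})" using e(1) Suc.prems by (auto simp: rejected_def)
    then have "insert e (Z - {e}) \<in> \<I>" using I e(1) Suc.prems assms(2) by (intro insert_indep_iff) auto
    then show ?case using e(1) by (simp add: insert_absorb)
  qed
  then show ?thesis by simp
qed

text \<open>Induction from the largest key downwards: a rejected element is spanned by elements of
  larger key, which are at least as heavy and are themselves already spanned by accepted elements of
  sufficient weight.\<close>

lemma greedy_dominates:
  assumes "finite X" "X \<subseteq> E" "\<And>x y. x \<in> X \<Longrightarrow> y \<in> X \<Longrightarrow> k x < k y \<Longrightarrow> h x \<le> h y"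
  shows "dominates h (X - rejected k X) X"
proof -
  define G where "G = X - rejected k X"
  define N where "N = Max (k ` X)"
  have N: "k x \<le> N" if "x \<in> X" for x using that assms(1) by (simp add: N_def)
  have "e \<in> cl {f \<in> G. h e \<le> h f}" if "e \<in> X" for e
    using that
  proof (induction "N - k e" arbitrary: e rule: less_induct)
    case less
    show ?case
    proof (cases "e \<in> G")
      case True
      then have "e \<in> {f \<in> G. h e \<le> h f}" by simp
      moreover have "G \<subseteq> E" using assms by (auto simp: G_def)
      ultimately show ?thesis using cl_superset[of "{f \<in> G. h e \<le> h f}"] by blast
    next
      case False
      then have "e \<in> cl {f \<in> X. k e < k f}" using less.prems by (auto simp: G_def rejected_def)
      moreover have "{f \<in> X. k e < k f} \<subseteq> cl {f \<in> G. h e \<le> h f}"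
      proof
        fix f assume f: "f \<in> {f \<in> X. k e < k f}"
        then have "k e < k f" "k f \<le> N" using N[of f] by auto
        then have "N - k f < N - k e" by arith
        then have "f \<in> cl {f' \<in> G. h f \<le> h f'}" using less.hyps f by blast
        moreover have "h e \<le> h f" using assms(3) less.prems f by auto
        ultimately show "f \<in> cl {f \<in> G. h e \<le> h f}"
          using cl_mono[of "{f' \<in> G. h f \<le> h f'}" "{f \<in> G. h e \<le> h f}"] by force
      qed
      ultimately show ?thesis using cl_subset_cl by blast
    qed
  qed
  then show ?thesis by (simp add: dominates_def G_def)
qed

lemma opt_basis_exists:
  assumes "X \<subseteq> E" obtains T where "opt_basis h X T"
proof -
  have fin: "finite X" using assms finite_ground finite_subset by blast
  obtain k :: "'a \<Rightarrow> nat" where "inj_on k X" "\<And>x y. x \<in> X \<Longrightarrow> y \<in> X \<Longrightarrow> k x < k y \<Longrightarrow> h x \<le> h y"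
    using inj_key_refining[OF fin] by blast
  then have "opt_basis h X (X - rejected k X)"
    using greedy_indep greedy_dominates fin assms by (auto simp: opt_basis_def)
  then show thesis by (rule that)
qed

text \<open>Exchange argument: if \<open>e\<close> were not spanned by the elements of
  \<open>T\<close> at least as heavy, these together with \<open>e\<close> would extend within
  \<open>insert e T\<close> to a set of size \<open>card T\<close>. This trades a strictly lighter
  \<open>f\<close> for \<open>e\<close>.\<close>

lemma arg_max_opt_basis:
  assumes "is_arg_max (sum h) (\<lambda>Y. Y \<in> \<I> \<and> Y \<subseteq> X) T" "X \<subseteq> E" "\<And>e. e \<in> X \<Longrightarrow> 0 < h e"
  shows "opt_basis h X T"
proof -
  have T: "T \<in> \<I>" "T \<subseteq> X" and max: "\<And>Y. Y \<in> \<I> \<Longrightarrow> Y \<subseteq> X \<Longrightarrow> sum h Y \<le> sum h T"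
    using assms(1) by (auto simp: is_arg_max_def not_less)
  have fin: "finite T" using T finite_indep by simp
  have "e \<in> cl {f \<in> T. h e \<le> h f}" if e: "e \<in> X" for e
  proof (rule ccontr)
    let ?L = "{f \<in> T. h e \<le> h f}"
    assume n: "e \<notin> cl ?L"
    have L: "?L \<in> \<I>" using T by (auto intro: indep_subset)
    have eE: "e \<in> E" using e assms(2) by auto
    have iL: "insert e ?L \<in> \<I>" using insert_indep_iff[OF L eE n] .
    have "?L \<subseteq> E" using T assms(2) by auto
    then have eT: "e \<notin> T" using cl_superset[of ?L] n by auto
    \<comment> \<open>Positivity of \<open>h e\<close> excludes adding \<open>e\<close> to
      \<open>T\<close> without a swap.\<close>
    have niT: "insert e T \<notin> \<I>"
    proof
      assume "insert e T \<in> \<I>"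
      then have "sum h (insert e T) \<le> sum h T" using T e by (intro max) auto
      then show False using eT fin assms(3)[OF e] by simp
    qed
    then have "?L \<noteq> T" using iL by metis
    then have "?L \<subset> T" by auto
    then have "card ?L < card T" using fin by (simp add: psubset_card_mono)
    moreover have "card (insert e ?L) = Suc (card ?L)" using eT fin by simp
    ultimately have "card (insert e ?L) \<le> card T" by simp
    then obtain B where B: "B \<in> \<I>" "insert e ?L \<subseteq> B" "B \<subseteq> insert e ?L \<union> T" "card B = card T"
      using indep_extend_card[OF iL T(1)] by metis
    have "B \<subseteq> insert e T" using B(3) by auto
    moreover have "B \<noteq> insert e T" using B(4) eT fin by auto
    ultimately obtain f where f: "f \<in> T" "f \<notin> B" using B(2) by auto
    have Beq: "B = insert e (T - {f})"
    proof (rule card_subset_eq)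
      show "finite (insert e (T - {f}))" using fin by simp
      show "B \<subseteq> insert e (T - {f})" using \<open>B \<subseteq> insert e T\<close> f by auto
      show "card B = card (insert e (T - {f}))" using B(4) eT fin card_Suc_Diff1[OF fin f(1)] by simp
    qed
    have "h f < h e" using f B(2) by force
    moreover have "sum h B \<le> sum h T" using B T e Beq by (intro max) auto
    moreover have "sum h B = h e + sum h T - h f"
      using Beq eT fin f(1) by (simp add: sum_diff1)
    ultimately show False by simp
  qed
  then show ?thesis using T by (simp add: opt_basis_def dominates_def)
qed

section \<open>Weights of optimal bases and the local-ratio inequality\<close>

text \<open>The elements of \<open>X\<close> with threshold at least \<open>\<theta>\<close> are
  independent and lie in the span of a level set of \<open>S\<close>, so they number at most its
  rank, which \<open>T\<close> attains at that level.\<close>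

lemma sum_threshold_le:
  assumes "X \<in> \<I>" "\<And>e. e \<in> X \<Longrightarrow> threshold h S e (\<tau> e)" "opt_basis h S T"
    and "\<And>f. f \<in> T \<Longrightarrow> 0 \<le> h f"
  shows "sum \<tau> X \<le> sum h T"
proof (rule sum_le_sum_of_level_card_le)
  fix \<theta> :: real assume "0 < \<theta>"
  then have "{x \<in> X. \<theta> \<le> \<tau> x} \<subseteq> cl {f \<in> S. \<theta> \<le> h f}"
    using assms(2) by (auto simp: threshold_def)
  then have "rk {x \<in> X. \<theta> \<le> \<tau> x} \<le> rk {f \<in> S. \<theta> \<le> h f}" by (rule rk_le_of_subset_cl)
  moreover have "{x \<in> X. \<theta> \<le> \<tau> x} \<in> \<I>" using assms(1) by (auto intro: indep_subset)
  ultimately show "card {x \<in> X. \<theta> \<le> \<tau> x} \<le> card {y \<in> T. \<theta> \<le> h y}"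
    unfolding opt_basis_card_level[OF assms(3)] by (simp add: rk_indep)
qed (use assms finite_indep in \<open>auto simp: opt_basis_def\<close>)

text \<open>Adding \<open>e\<close> raises the rank of the level set at a positive
  \<open>\<theta>\<close> exactly when \<open>t < \<theta> \<le> h e\<close>; hence the maximum
  weight grows by \<open>h e - t\<close>.\<close>

lemma opt_basis_insert:
  assumes "opt_basis h X B" "opt_basis h (insert e X) T" "threshold h X e t" "t \<le> h e"
    and "e \<notin> X" "e \<in> E" "\<And>f. f \<in> X \<Longrightarrow> 0 \<le> h f"
  shows "sum h T + t = sum h B + h e"
proof -
  \<comment> \<open>The artificial element \<open>None\<close> carries the weights \<open>t\<close>
    and \<open>h e\<close>, so that the identity becomes an equality of level counts of nonnegative
    functions.\<close>
  let ?T = "insert None (Some ` T)" and ?B = "insert None (Some ` B)"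
  let ?f = "\<lambda>x. case x of None \<Rightarrow> t | Some x \<Rightarrow> h x"
  let ?g = "\<lambda>x. case x of None \<Rightarrow> h e | Some x \<Rightarrow> h x"
  have fin: "finite T" "finite B" using assms(1,2) finite_indep by (auto simp: opt_basis_def)
  have t: "0 \<le> t" using assms(3) by (simp add: threshold_def)
  have nn: "0 \<le> h f" if "f \<in> T \<union> B" for f
    using that assms t by (auto simp: opt_basis_def)
  have "sum ?f ?T = sum ?g ?B"
  proof (rule sum_eq_sum_of_level_card_eq)
    fix \<theta> :: real assume \<theta>: "0 < \<theta>"
    have level: "card {x \<in> insert None (Some ` Y). \<theta> \<le> (case x of None \<Rightarrow> c | Some x \<Rightarrow> h x)} =
        card {x \<in> Y. \<theta> \<le> h x} + (if \<theta> \<le> c then 1 else 0)" if "finite Y" for Y and c :: real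
    proof -
      have *: "{x \<in> insert None (Some ` Y). \<theta> \<le> (case x of None \<Rightarrow> c | Some x \<Rightarrow> h x)} =
        Some ` {x \<in> Y. \<theta> \<le> h x} \<union> (if \<theta> \<le> c then {None} else {})" by auto
      have "card (Some ` {x \<in> Y. \<theta> \<le> h x}) = card {x \<in> Y. \<theta> \<le> h x}"
        by (rule card_image) auto
      then show ?thesis unfolding * using that by (auto simp: card_insert_if)
    qed
    have "rk {f \<in> insert e X. \<theta> \<le> h f} + (if \<theta> \<le> t then 1 else 0) =
        rk {f \<in> X. \<theta> \<le> h f} + (if \<theta> \<le> h e then 1 else 0)"
    proof (cases "\<theta> \<le> h e")
      case True
      then have "{f \<in> insert e X. \<theta> \<le> h f} = insert e {f \<in> X. \<theta> \<le> h f}" by auto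
      then show ?thesis using True rk_insert[OF assms(6)] assms(3) \<theta> by (simp add: threshold_def)
    next
      case False
      then have "{f \<in> insert e X. \<theta> \<le> h f} = {f \<in> X. \<theta> \<le> h f}" by auto
      then show ?thesis using False assms(4) by simp
    qed
    then show "card {x \<in> ?T. \<theta> \<le> ?f x} = card {y \<in> ?B. \<theta> \<le> ?g y}"
      using level[OF fin(1)] level[OF fin(2)] opt_basis_card_level[OF assms(1)]
        opt_basis_card_level[OF assms(2)] by simp
  qed (use fin nn t assms(4) in auto)
  then show ?thesis using fin by (simp add: sum.reindex)
qed

text \<open>Invariant of the run for one matroid; \<open>A\<close> is the set of all elements kept so far,
  including those that were removed later.\<close>

definition local_ratio :: "('a \<Rightarrow> real) \<Rightarrow> ('a \<Rightarrow> real) \<Rightarrow> 'a set \<Rightarrow> bool" where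
  "local_ratio h g A \<longleftrightarrow> (\<forall>X\<subseteq>A. \<forall>T. opt_basis h X T \<longrightarrow> sum g X \<le> sum h T)
     \<and> (\<forall>T. opt_basis h A T \<longrightarrow> sum h T = sum g A)"

lemma local_ratio_cong:
  assumes "\<And>f. f \<in> A \<Longrightarrow> h f = h' f" "\<And>f. f \<in> A \<Longrightarrow> g f = g' f"
  shows "local_ratio h g A \<longleftrightarrow> local_ratio h' g' A"
proof -
  have "opt_basis h X T \<longleftrightarrow> opt_basis h' X T" if "X \<subseteq> A" for X T
    using that assms(1) by (intro opt_basis_cong) auto
  moreover have "opt_basis h X T \<Longrightarrow> sum h T = sum h' T" if "X \<subseteq> A" for X T
    using that assms(1) by (intro sum.cong) (auto simp: opt_basis_def)
  moreover have "sum g X = sum g' X" if "X \<subseteq> A" for X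
    using that assms(2) by (intro sum.cong) auto
  ultimately show ?thesis unfolding local_ratio_def by (metis order_refl)
qed

lemma local_ratio_empty: "local_ratio h g {}"
  by (auto simp: local_ratio_def opt_basis_def)

text \<open>If \<open>X\<close> contains \<open>e\<close>, the threshold \<open>s\<close> over the
  rest of \<open>X\<close> is at most \<open>t\<close>, so the optimum grows by
  \<open>h e - s \<ge> h e - t = g e\<close>. For all of \<open>insert e A\<close> the threshold is
  \<open>t\<close> itself, which gives equality.\<close>

lemma local_ratio_insert:
  assumes "local_ratio h g A" "threshold h A e t" "h e = g e + t" "0 \<le> g e"
    and "A \<subseteq> E" "e \<in> E" "e \<notin> A" "e \<notin> cl {}" "\<And>f. f \<in> A \<Longrightarrow> 0 \<le> h f"
  shows "local_ratio h g (insert e A)"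
  unfolding local_ratio_def
proof (intro conjI allI impI)
  have fin: "finite A" using assms(5) finite_ground finite_subset by blast
  fix X T assume X: "X \<subseteq> insert e A" and T: "opt_basis h X T"
  show "sum g X \<le> sum h T"
  proof (cases "e \<in> X")
    case False
    then show ?thesis using X T assms(1) by (auto simp: local_ratio_def subset_insert)
  next
    case True
    define Y where "Y = X - {e}"
    have Y: "Y \<subseteq> A" "X = insert e Y" "e \<notin> Y" "finite Y"
      using X True fin finite_subset[of Y A] by (auto simp: Y_def)
    obtain B where B: "opt_basis h Y B" using opt_basis_exists[of Y h] Y assms(5) by blast
    obtain s where s: "threshold h Y e s" using threshold_exists Y assms(8) by blast
    have "s \<le> t" using threshold_mono[OF s assms(2)] dominates_superset[OF Y(1) assms(5)] by simp
    moreover have "sum h T + s = sum h B + h e"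
      using Y assms \<open>s \<le> t\<close> T by (intro opt_basis_insert[OF B _ s]) auto
    moreover have "sum g Y \<le> sum h B" using assms(1) B Y by (auto simp: local_ratio_def)
    ultimately show ?thesis using Y assms(3) by simp
  qed
next
  have fin: "finite A" using assms(5) finite_ground finite_subset by blast
  fix T assume T: "opt_basis h (insert e A) T"
  obtain B where B: "opt_basis h A B" using opt_basis_exists[of A h] assms(5) by blast
  have "sum h T + t = sum h B + h e"
    using assms T by (intro opt_basis_insert[OF B _ assms(2)]) auto
  moreover have "sum h B = sum g A" using assms(1) B by (auto simp: local_ratio_def)
  ultimately show "sum h T = sum g (insert e A)" using assms(3,7) fin by simp
qed

end

section \<open>Kernels of two matroids\<close>

text \<open>Fleiner's matroid kernel. A fixed point \<open>A = S - rejected\<^sub>2 (S - rejected\<^sub>1 A)\<close> exists by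
  Knaster--Tarski; with \<open>B = S - rejected\<^sub>1 A\<close> one has \<open>S = A \<union> B\<close>, and \<open>A \<inter> B\<close> is the
  greedy basis of \<open>A\<close> in the first and of \<open>B\<close> in the second matroid.\<close>

lemma matroid_kernel:
  assumes "matroid E \<I>1" "matroid E \<I>2" "S \<subseteq> E"
  obtains T where "T \<in> \<I>1" "T \<in> \<I>2" "T \<subseteq> S"
    and "\<And>e. e \<in> S \<Longrightarrow> matroid.dominates E \<I>1 h1 T {e} \<or> matroid.dominates E \<I>2 h2 T {e}"
proof -
  interpret M1: matroid E \<I>1 by fact
  interpret M2: matroid E \<I>2 by fact
  have fin: "finite S" using assms(3) M1.finite_ground finite_subset by blast
  obtain k1 :: "'a \<Rightarrow> nat" where k1: "inj_on k1 S"
    "\<And>x y. x \<in> S \<Longrightarrow> y \<in> S \<Longrightarrow> k1 x < k1 y \<Longrightarrow> h1 x \<le> h1 y"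
    using inj_key_refining[OF fin, where h = h1] by blast
  obtain k2 :: "'a \<Rightarrow> nat" where k2: "inj_on k2 S"
    "\<And>x y. x \<in> S \<Longrightarrow> y \<in> S \<Longrightarrow> k2 x < k2 y \<Longrightarrow> h2 x \<le> h2 y"
    using inj_key_refining[OF fin, where h = h2] by blast
  define F where "F A = S - M2.rejected k2 (S - M1.rejected k1 A)" for A
  \<comment> \<open>The two complements reverse inclusion twice.\<close>
  have "mono F"
  proof
    fix A A' :: "'a set" assume "A \<subseteq> A'"
    then have "S - M1.rejected k1 A' \<subseteq> S - M1.rejected k1 A" using M1.rejected_mono by blast
    then show "F A \<subseteq> F A'" unfolding F_def using M2.rejected_mono by blast
  qed
  define A where "A = lfp F"
  define B where "B = S - M1.rejected k1 A"
  have A: "A = S - M2.rejected k2 B" using lfp_unfold[OF \<open>mono F\<close>] by (simp add: A_def B_def F_def)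
  have sub: "M1.rejected k1 A \<subseteq> A" "M2.rejected k2 B \<subseteq> B"
    by (auto simp: M1.rejected_def M2.rejected_def)
  have AS: "A \<subseteq> S" "B \<subseteq> S" "finite A" "finite B" using A B_def fin by (auto intro: finite_subset)
  have AE: "A \<subseteq> E" "B \<subseteq> E" using AS assms(3) by auto
  define T where "T = A \<inter> B"
  have T1: "T = A - M1.rejected k1 A" using AS by (auto simp: T_def B_def)
  have T2: "T = B - M2.rejected k2 B" using AS A by (auto simp: T_def)
  show thesis
  proof
    show "T \<in> \<I>1" unfolding T1 using AS AE inj_on_subset[OF k1(1)] by (intro M1.greedy_indep)
    show "T \<in> \<I>2" unfolding T2 using AS AE inj_on_subset[OF k2(1)] by (intro M2.greedy_indep)
    show "T \<subseteq> S" using AS by (auto simp: T_def)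
    have 1: "M1.dominates h1 T A" unfolding T1 using AS AE by (intro M1.greedy_dominates k1(2)) auto
    have 2: "M2.dominates h2 T B" unfolding T2 using AS AE by (intro M2.greedy_dominates k2(2)) auto
    fix e assume "e \<in> S"
    \<comment> \<open>What lies in \<open>S\<close> outside \<open>B\<close> was rejected from
      \<open>A\<close>, so it belongs to \<open>A\<close>.\<close>
    then have "e \<in> A \<or> e \<in> B" using sub(1) by (auto simp: B_def)
    then show "M1.dominates h1 T {e} \<or> M2.dominates h2 T {e}"
      using 1 2 by (auto simp: M1.dominates_def M2.dominates_def)
  qed
qed

section \<open>The invariant for one matroid and its consequences\<close>

context matroid
begin

text \<open>\<open>S\<close> is the stored set, \<open>A\<close> everything ever kept. Domination
  says that removals preserve all thresholds; the factor \<open>1 + 1 / \<epsilon>\<close> records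
  that acceptance forces a threshold of at most \<open>g e / \<epsilon>\<close>.\<close>

definition side_inv ::
  "real \<Rightarrow> ('a \<Rightarrow> real) \<Rightarrow> ('a \<Rightarrow> real) \<Rightarrow> 'a set \<Rightarrow> 'a set \<Rightarrow> bool" where
  "side_inv \<epsilon> h g S A \<longleftrightarrow> S \<subseteq> A \<and> A \<subseteq> E \<and> dominates h S A \<and> local_ratio h g A \<and>
     (\<forall>e\<in>A. e \<notin> cl {} \<and> 0 < g e \<and> g e \<le> h e \<and> h e \<le> (1 + 1 / \<epsilon>) * g e)"

lemma side_inv_threshold:
  "side_inv \<epsilon> h g S A \<Longrightarrow> threshold h S e t \<longleftrightarrow> threshold h A e t"
  using threshold_transfer[of h S e t A] threshold_transfer[of h A e t S] dominates_superset[of S A h]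
  by (auto simp: side_inv_def)

text \<open>The removal rule spares the maximum-weight set \<open>T\<close>, which dominates
  \<open>insert e S\<close>; this in turn dominates \<open>insert e A\<close>, and domination is
  transitive.\<close>

lemma side_inv_insert:
  assumes inv: "side_inv \<epsilon> h g S A" and t: "threshold h S e t"
    and e: "e \<in> E" "e \<notin> A" "e \<notin> cl {}" and ge: "0 < ge" "t \<le> ge / \<epsilon>"
    and h': "h' = h(e := ge + t)" and g': "g' = g(e := ge)"
    and T: "is_arg_max (sum h') (\<lambda>X. X \<in> \<I> \<and> X \<subseteq> insert e S) T" "T \<subseteq> S'" "S' \<subseteq> insert e S"
  shows "side_inv \<epsilon> h' g' S' (insert e A)"
proof -
  have SA: "S \<subseteq> A" "A \<subseteq> E" and dom: "dominates h S A" and lr: "local_ratio h g A"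
    and pt: "\<And>e. e \<in> A \<Longrightarrow> e \<notin> cl {} \<and> 0 < g e \<and> g e \<le> h e \<and> h e \<le> (1 + 1 / \<epsilon>) * g e"
    using inv by (auto simp: side_inv_def)
  have hA: "h f = h' f" "g f = g' f" if "f \<in> A" for f using that e(2) by (auto simp: h' g')
  have t0: "0 \<le> t" using t by (simp add: threshold_def)
  have tA: "threshold h' A e t"
    using t side_inv_threshold[OF inv] threshold_cong[of A h h'] hA by simp
  have lr': "local_ratio h' g' (insert e A)"
  proof (rule local_ratio_insert[OF _ tA])
    show "local_ratio h' g' A" using lr local_ratio_cong[of A h h' g g'] hA by simp
    show "0 \<le> h' f" if "f \<in> A" for f using pt[OF that] hA[OF that] by simp
  qed (use e SA ge in \<open>auto simp: h' g'\<close>)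
  have iE: "insert e S \<subseteq> E" using SA e by auto
  have "0 < h' f" if "f \<in> insert e S" for f
    using that pt[of f] SA ge t0 by (fastforce simp: h')
  then have "dominates h' T (insert e S)"
    using arg_max_opt_basis[OF T(1) iE] by (simp add: opt_basis_def)
  then have "dominates h' S' (insert e S)" using T(2) by (rule dominates_mono)
  moreover have "dominates h' (insert e S) (insert e A)"
  proof -
    have "dominates h' S A" using dom dominates_cong[of S A h h'] hA SA by auto
    then have "dominates h' (insert e S) A" by (rule dominates_mono) auto
    moreover have "dominates h' (insert e S) {e}" using iE by (intro dominates_superset) auto
    ultimately show ?thesis by (simp add: dominates_def)
  qed
  ultimately have "dominates h' S' (insert e A)" by (rule dominates_trans)
  moreover have "f \<notin> cl {} \<and> 0 < g' f \<and> g' f \<le> h' f \<and> h' f \<le> (1 + 1 / \<epsilon>) * g' f"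
    if "f \<in> insert e A" for f
    using that pt[of f] e ge t0 by (auto simp: h' g' algebra_simps)
  ultimately show ?thesis using lr' SA T(3) e by (auto simp: side_inv_def)
qed

lemma threshold_insert_grows:
  assumes "threshold h A x t" "A \<subseteq> E" "e \<in> E" "e \<notin> A" "x \<notin> cl {}"
  obtains t' where "threshold (h(e := c)) (insert e A) x t'" "t \<le> t'"
proof -
  have "finite (insert e A)" using assms(2) finite_ground finite_subset by auto
  then obtain t' where t': "threshold (h(e := c)) (insert e A) x t'"
    using threshold_exists assms(5) by blast
  have "threshold (h(e := c)) A x t"
    using assms(1,4) threshold_cong[of A h "h(e := c)" x t] by fastforce
  moreover have "dominates (h(e := c)) (insert e A) A"
    using assms(2,3) by (intro dominates_superset) auto
  ultimately have "t \<le> t'" by (rule threshold_mono[OF _ t'])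
  then show thesis using t' that by blast
qed

lemma side_inv_opt_basis:
  assumes "side_inv \<epsilon> h g S A" "opt_basis h S T" shows "opt_basis h A T"
  using assms dominates_trans[of h T S A] by (auto simp: side_inv_def opt_basis_def)

text \<open>An optimal basis of \<open>X\<close> has at most \<open>rk E\<close> elements, each of
  weight at most \<open>c\<close>, and its weight bounds the gain of \<open>X\<close>. This serves
  to bound the removed elements.\<close>

lemma side_inv_sum_le_card:
  assumes inv: "side_inv \<epsilon> h g S A" and "X \<subseteq> A" and c: "\<And>e. e \<in> X \<Longrightarrow> h e \<le> c" "0 \<le> c"
  shows "sum g X \<le> real (rk E) * c"
proof -
  have A: "A \<subseteq> E" "local_ratio h g A" using inv by (auto simp: side_inv_def)
  obtain T where T: "opt_basis h X T" using opt_basis_exists[of X h] assms(2) A by blast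
  then have "sum g X \<le> sum h T" using A assms(2) by (auto simp: local_ratio_def)
  also have "\<dots> \<le> real (card T) * c"
    using c(1) T by (intro sum_bounded_above) (auto simp: opt_basis_def)
  also have "\<dots> \<le> real (rk E) * c"
    using T c(2) card_le_rk[of T E] indep_subset_ground
    by (intro mult_right_mono) (auto simp: opt_basis_def)
  finally show ?thesis .
qed

text \<open>By domination an optimal basis of \<open>S\<close> is one of \<open>A\<close>, so its
  weight is the total gain; the pointwise bound on \<open>h\<close> then passes to gains.\<close>

lemma side_inv_total_le_stored:
  assumes inv: "side_inv \<epsilon> h g S A" and "0 < \<epsilon>"
  shows "sum g A \<le> (1 + 1 / \<epsilon>) * sum g S"
proof -
  have A: "S \<subseteq> A" "A \<subseteq> E" "local_ratio h g A"
    and pt: "\<And>e. e \<in> A \<Longrightarrow> 0 < g e \<and> h e \<le> (1 + 1 / \<epsilon>) * g e"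
    using inv by (auto simp: side_inv_def)
  obtain T where T: "opt_basis h S T" using opt_basis_exists[of S h] A by blast
  have TS: "T \<subseteq> S" using T by (simp add: opt_basis_def)
  have "finite S" using A finite_ground finite_subset by (metis (no_types, lifting))
  have "sum g A = sum h T"
    using side_inv_opt_basis[OF inv T] A(3) by (simp add: local_ratio_def)
  also have "\<dots> \<le> (\<Sum>e\<in>T. (1 + 1 / \<epsilon>) * g e)" using TS A(1) pt by (intro sum_mono) auto
  also have "\<dots> = (1 + 1 / \<epsilon>) * sum g T" by (simp add: sum_distrib_left)
  also have "\<dots> \<le> (1 + 1 / \<epsilon>) * sum g S"
    using TS A(1) pt \<open>finite S\<close> assms(2)
    by (intro mult_left_mono sum_mono2) (auto simp: less_imp_le)
  finally show ?thesis .
qed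

lemma side_inv_sum_threshold_le:
  assumes inv: "side_inv \<epsilon> h g S A" and "X \<in> \<I>" "\<And>e. e \<in> X \<Longrightarrow> threshold h A e (\<tau> e)"
  shows "sum \<tau> X \<le> sum g A"
proof -
  have A: "A \<subseteq> E" "local_ratio h g A" and pt: "\<And>e. e \<in> A \<Longrightarrow> 0 \<le> h e"
    using inv by (force simp: side_inv_def)+
  obtain T where T: "opt_basis h A T" using opt_basis_exists[of A h] A by blast
  have "sum \<tau> X \<le> sum h T"
    using assms(2,3) T pt by (intro sum_threshold_le) (auto simp: opt_basis_def)
  then show ?thesis using T A by (simp add: local_ratio_def)
qed

text \<open>An independent \<open>T\<close> is an optimal basis of the stored elements that it
  dominates, and \<open>local_ratio\<close> covers arbitrary subsets of \<open>A\<close>.\<close>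

lemma side_inv_dominated_le:
  assumes inv: "side_inv \<epsilon> h g S A" and "T \<in> \<I>" "T \<subseteq> S"
  shows "sum g {e \<in> S. dominates h T {e}} \<le> sum h T"
proof -
  have A: "S \<subseteq> A" "A \<subseteq> E" "local_ratio h g A" using inv by (auto simp: side_inv_def)
  have "T \<subseteq> {e \<in> S. dominates h T {e}}"
    using assms(3) A by (auto intro!: dominates_superset)
  then have "opt_basis h {e \<in> S. dominates h T {e}} T"
    using assms(2) by (auto simp: opt_basis_def dominates_def)
  moreover have "{e \<in> S. dominates h T {e}} \<subseteq> A" using A(1) by blast
  ultimately show ?thesis using A(3) unfolding local_ratio_def by blast
qed

end

section \<open>The invariant of the whole run\<close>

locale matroid_pair = M1: matroid E \<I>1 + M2: matroid E \<I>2
  for E :: "'a set" and \<I>1 \<I>2 +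
  fixes w :: "'a \<Rightarrow> real" and \<epsilon> y :: real
  assumes eps_pos: "0 < \<epsilon>"
begin

text \<open>\<open>D\<close> holds the processed elements, \<open>A\<close> the kept ones. The
  threshold clause is what an optimal solution is charged to. The last clause assumes
  \<open>1 \<le> y\<close>, since otherwise an element of largest gain may itself be
  removed.\<close>

definition run_inv :: "'a set \<Rightarrow> 'a set \<Rightarrow> 'a ss_state \<Rightarrow> bool" where
  "run_inv D A \<sigma> \<longleftrightarrow> A \<subseteq> D \<and>
     M1.side_inv \<epsilon> (wt1 \<sigma>) (gain \<sigma>) (stored \<sigma>) A \<and>
     M2.side_inv \<epsilon> (wt2 \<sigma>) (gain \<sigma>) (stored \<sigma>) A \<and>
     (\<forall>e\<in>A. w e = wt1 \<sigma> e + wt2 \<sigma> e - gain \<sigma> e) \<and>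
     (\<forall>e\<in>D. e \<notin> M1.cl {} \<longrightarrow> e \<notin> M2.cl {} \<longrightarrow>
        (\<exists>t1 t2. M1.threshold (wt1 \<sigma>) A e t1 \<and> M2.threshold (wt2 \<sigma>) A e t2 \<and>
           w e \<le> (1 + \<epsilon>) * (t1 + t2))) \<and>
     (1 \<le> y \<longrightarrow> (\<forall>e\<in>A - stored \<sigma>. \<exists>m\<in>stored \<sigma>. y * gain \<sigma> e \<le> gain \<sigma> m))"

lemma run_inv_init: "run_inv {} {} ss_init"
  by (simp add: run_inv_def M1.side_inv_def M2.side_inv_def ss_init_def M1.local_ratio_empty
      M2.local_ratio_empty M1.dominates_def M2.dominates_def)

lemma keep_not_loop:
  assumes "ereal (w e) > ereal (1 + \<epsilon>) * (wstar E \<I>1 S h1 e + wstar E \<I>2 S h2 e)"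
  shows "e \<notin> M1.cl {} \<and> e \<notin> M2.cl {}"
proof (rule ccontr)
  assume "\<not> ?thesis"
  then have "wstar E \<I>1 S h1 e = \<infinity> \<or> wstar E \<I>2 S h2 e = \<infinity>"
    using M1.wstar_loop M2.wstar_loop by blast
  moreover have "0 \<le> wstar E \<I>1 S h1 e" "0 \<le> wstar E \<I>2 S h2 e"
    by (auto simp: wstar_def intro: Sup_upper)
  ultimately have "wstar E \<I>1 S h1 e + wstar E \<I>2 S h2 e = \<infinity>" by auto
  from assms[unfolded this] show False using eps_pos by simp
qed

lemma run_inv_step:
  assumes inv: "run_inv D A \<sigma>" and step: "ss_step E \<I>1 \<I>2 w (1 + \<epsilon>) y e \<sigma> \<sigma>'"
    and e: "e \<in> E" "e \<notin> D"
  shows "\<exists>A'. run_inv (insert e D) A' \<sigma>'"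
proof -
  let ?S = "stored \<sigma>"
  have AD: "A \<subseteq> D" and s1: "M1.side_inv \<epsilon> (wt1 \<sigma>) (gain \<sigma>) ?S A"
    and s2: "M2.side_inv \<epsilon> (wt2 \<sigma>) (gain \<sigma>) ?S A"
    and wA: "\<And>e. e \<in> A \<Longrightarrow> w e = wt1 \<sigma> e + wt2 \<sigma> e - gain \<sigma> e"
    and thr: "\<And>e. e \<in> D \<Longrightarrow> e \<notin> M1.cl {} \<Longrightarrow> e \<notin> M2.cl {} \<Longrightarrow>
        \<exists>t1 t2. M1.threshold (wt1 \<sigma>) A e t1 \<and> M2.threshold (wt2 \<sigma>) A e t2 \<and>
           w e \<le> (1 + \<epsilon>) * (t1 + t2)"
    and rem: "\<And>e. 1 \<le> y \<Longrightarrow> e \<in> A - ?S \<Longrightarrow> \<exists>m\<in>?S. y * gain \<sigma> e \<le> gain \<sigma> m"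
    using inv unfolding run_inv_def by blast+
  have SA: "?S \<subseteq> A" "A \<subseteq> E" using s1 by (auto simp: M1.side_inv_def)
  have finS: "finite ?S" using SA M1.finite_ground by (meson finite_subset)
  have eA: "e \<notin> A" using AD e by auto
  have gpos: "0 < gain \<sigma> f" if "f \<in> A" for f using s1 that by (auto simp: M1.side_inv_def)
  show ?thesis
    using step
  proof cases
    case (discard s1' s2')
    have "\<exists>t1 t2. M1.threshold (wt1 \<sigma>) A e t1 \<and> M2.threshold (wt2 \<sigma>) A e t2 \<and>
           w e \<le> (1 + \<epsilon>) * (t1 + t2)" if nl: "e \<notin> M1.cl {}" "e \<notin> M2.cl {}"
    proof -
      obtain t1 where t1: "M1.threshold (wt1 \<sigma>) ?S e t1" using M1.threshold_exists[OF finS nl(1)] by blast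
      obtain t2 where t2: "M2.threshold (wt2 \<sigma>) ?S e t2" using M2.threshold_exists[OF finS nl(2)] by blast
      have "w e \<le> (1 + \<epsilon>) * (t1 + t2)"
        using discard M1.wstar_threshold[OF t1] M2.wstar_threshold[OF t2] by simp
      then show ?thesis using t1 t2 M1.side_inv_threshold[OF s1] M2.side_inv_threshold[OF s2] by blast
    qed
    then have "run_inv (insert e D) A \<sigma>" using inv unfolding run_inv_def by blast
    then show ?thesis using discard by blast
  next
    case (keep s1' s2' ge S1 g w1 w2 T1 T2 gmax S')
    have nl: "e \<notin> M1.cl {}" "e \<notin> M2.cl {}" using keep_not_loop keep(4)[unfolded keep(2,3)] by blast+
    obtain t1 where t1: "M1.threshold (wt1 \<sigma>) ?S e t1" using M1.threshold_exists[OF finS nl(1)] by blast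
    obtain t2 where t2: "M2.threshold (wt2 \<sigma>) ?S e t2" using M2.threshold_exists[OF finS nl(2)] by blast
    have s: "s1' = ereal t1" "s2' = ereal t2"
      using keep(2,3) M1.wstar_threshold[OF t1] M2.wstar_threshold[OF t2] by auto
    have t0: "0 \<le> t1" "0 \<le> t2" using t1 t2 by (auto simp: M1.threshold_def M2.threshold_def)
    have big: "w e > (1 + \<epsilon>) * (t1 + t2)" using keep(4) s by simp
    have ge: "ge = w e - t1 - t2" using keep(5) s by simp
    \<comment> \<open>The acceptance test in terms of the gain: it yields positivity of
      \<open>ge\<close> and the bounds on \<open>t1\<close> and \<open>t2\<close> by
      \<open>ge / \<epsilon>\<close>.\<close>
    have gbig: "ge > \<epsilon> * (t1 + t2)" using big ge by (simp add: algebra_simps)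
    moreover have "0 \<le> \<epsilon> * (t1 + t2)" using t0 eps_pos by simp
    ultimately have ge0: "0 < ge" by linarith
    have "0 \<le> t1 * \<epsilon>" "0 \<le> t2 * \<epsilon>" "t1 * \<epsilon> + t2 * \<epsilon> < ge"
      using gbig t0 eps_pos by (simp_all add: algebra_simps)
    then have "t1 * \<epsilon> \<le> ge" "t2 * \<epsilon> \<le> ge" by linarith+
    then have tge: "t1 \<le> ge / \<epsilon>" "t2 \<le> ge / \<epsilon>" using eps_pos by (simp_all add: pos_le_divide_eq)
    let ?A = "insert e A"
    have w1: "w1 = (wt1 \<sigma>)(e := ge + t1)" and w2: "w2 = (wt2 \<sigma>)(e := ge + t2)"
      using keep(8,9) s by simp_all
    have TS: "T1 \<subseteq> insert e ?S" "T2 \<subseteq> insert e ?S" using keep(6,10,11) by (auto simp: is_arg_max_def)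
    have S': "T1 \<subseteq> S'" "T2 \<subseteq> S'" "S' \<subseteq> insert e ?S" using keep(6,13) TS by auto
    have i1: "M1.side_inv \<epsilon> w1 g S' ?A"
      using keep(6,10) S'(3) by (intro M1.side_inv_insert[OF s1 t1 e(1) eA nl(1) ge0 tge(1) w1 keep(7) _ S'(1)]) auto
    have i2: "M2.side_inv \<epsilon> w2 g S' ?A"
      using keep(6,11) S'(3) by (intro M2.side_inv_insert[OF s2 t2 e(1) eA nl(2) ge0 tge(2) w2 keep(7) _ S'(2)]) auto
    have w_eq: "w f = w1 f + w2 f - g f" if "f \<in> ?A" for f
      using that wA[of f] eA keep(7) by (auto simp: w1 w2 ge)
    have thr': "\<exists>t1 t2. M1.threshold w1 ?A f t1 \<and> M2.threshold w2 ?A f t2 \<and>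
           w f \<le> (1 + \<epsilon>) * (t1 + t2)"
      if f: "f \<in> insert e D" "f \<notin> M1.cl {}" "f \<notin> M2.cl {}" for f
    proof (cases "f = e")
      case True
      \<comment> \<open>A kept \<open>e\<close> spans itself at its own levels, so its new
        thresholds are at least \<open>w1 e\<close> and \<open>w2 e\<close>, whose sum is
        \<open>w e + ge\<close>.\<close>
      have A: "finite ?A" "?A \<subseteq> E" using SA e M1.finite_ground by (auto intro: finite_subset)
      obtain u1 where u1: "M1.threshold w1 ?A e u1" using M1.threshold_exists[OF A(1) nl(1)] by blast
      obtain u2 where u2: "M2.threshold w2 ?A e u2" using M2.threshold_exists[OF A(1) nl(2)] by blast
      have u: "w1 e \<le> u1" "w2 e \<le> u2"
        using M1.threshold_self[OF u1] M2.threshold_self[OF u2] A by auto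
      then have "w e \<le> u1 + u2" using ge0 by (simp add: w1 w2 ge)
      moreover have "0 \<le> \<epsilon> * (u1 + u2)"
        using u1 u2 eps_pos by (auto simp: M1.threshold_def M2.threshold_def)
      ultimately have "w e \<le> (1 + \<epsilon>) * (u1 + u2)" by (simp add: algebra_simps)
      then show ?thesis using u1 u2 True by blast
    next
      case False
      \<comment> \<open>Thresholds only grow when an element is kept, so earlier bounds
        persist.\<close>
      then obtain v1 v2 where v: "M1.threshold (wt1 \<sigma>) A f v1" "M2.threshold (wt2 \<sigma>) A f v2"
        "w f \<le> (1 + \<epsilon>) * (v1 + v2)" using thr f by blast
      obtain u1 where u1: "M1.threshold w1 ?A f u1" "v1 \<le> u1"
        using M1.threshold_insert_grows[OF v(1) SA(2) e(1) eA f(2)] unfolding w1 by blast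
      obtain u2 where u2: "M2.threshold w2 ?A f u2" "v2 \<le> u2"
        using M2.threshold_insert_grows[OF v(2) SA(2) e(1) eA f(3)] unfolding w2 by blast
      have "(1 + \<epsilon>) * (v1 + v2) \<le> (1 + \<epsilon>) * (u1 + u2)"
        using u1 u2 eps_pos by (intro mult_left_mono) auto
      then show ?thesis using u1 u2 v(3) by force
    qed
    have rem': "\<exists>m\<in>S'. y * g x \<le> g m" if y: "1 \<le> y" and x: "x \<in> ?A - S'" for x
    proof -
      have fin: "finite (g ` S1)" and ne: "g ` S1 \<noteq> {}" using finS keep(6) by auto
      have "gmax \<in> g ` S1" using Max_in[OF fin ne] keep(12) by simp
      \<comment> \<open>An element of largest gain survives because \<open>1 \<le> y\<close>. It is
        the witness also for elements removed earlier, whose old witness may disappear now.\<close>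
      then obtain m where m: "m \<in> S1" "g m = gmax" by auto
      have le: "g f \<le> gmax" if "f \<in> S1" for f using that Max_ge[OF fin] keep(12) by simp
      have "0 < g m" using m(1) gpos SA ge0 keep(6,7) by (auto simp: fun_upd_def)
      then have "gmax \<le> y * gmax" using m y by (simp add: mult_le_cancel_right1)
      then have mS': "m \<in> S'" using m keep(13) by auto
      have "y * g x \<le> gmax"
      proof (cases "x \<in> S1")
        case True
        then show ?thesis using x keep(13) by auto
      next
        case False
        then have xA: "x \<in> A - ?S" using x keep(6) by auto
        then obtain m' where m': "m' \<in> ?S" "y * gain \<sigma> x \<le> gain \<sigma> m'" using rem[OF y] by blast
        then have "g x = gain \<sigma> x" "g m' = gain \<sigma> m'" "m' \<in> S1" using xA eA SA keep(6,7) by auto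
        then show ?thesis using m' le[of m'] by simp
      qed
      then show ?thesis using m mS' by auto
    qed
    have "run_inv (insert e D) ?A \<lparr>stored = S', gain = g, wt1 = w1, wt2 = w2\<rparr>"
      unfolding run_inv_def ss_state.simps
    proof (intro conjI ballI impI)
      show "?A \<subseteq> insert e D" using AD by auto
    qed (fact i1 i2 | rule w_eq thr' rem'; assumption)+
    then show ?thesis using keep(1) by blast
  qed
qed

lemma run_inv_run:
  assumes "ss_run E \<I>1 \<I>2 w (1 + \<epsilon>) y es \<sigma> \<sigma>'" "run_inv D A \<sigma>" "distinct es"
    "set es \<subseteq> E" "set es \<inter> D = {}"
  shows "\<exists>A'. run_inv (D \<union> set es) A' \<sigma>'"
  using assms
proof (induction arbitrary: D A rule: ss_run.induct)
  case (Nil \<sigma>)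
  then show ?case by auto
next
  case (Cons e \<sigma> \<sigma>1 es \<sigma>2)
  then obtain A' where A': "run_inv (insert e D) A' \<sigma>1" using run_inv_step[of D A \<sigma> e \<sigma>1] by auto
  have "\<exists>A''. run_inv (insert e D \<union> set es) A'' \<sigma>2"
    using Cons.prems by (intro Cons.IH[OF A']) auto
  then show ?case by simp
qed

section \<open>The common independent set and the bounds on optimum and total gain\<close>

lemma run_inv_common_indep:
  assumes inv: "run_inv D A \<sigma>"
  obtains T where "T \<in> \<I>1" "T \<in> \<I>2" "T \<subseteq> stored \<sigma>" "sum (gain \<sigma>) (stored \<sigma>) \<le> sum w T"
proof -
  let ?S = "stored \<sigma>" and ?g = "gain \<sigma>" and ?h1 = "wt1 \<sigma>" and ?h2 = "wt2 \<sigma>"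
  have s1: "M1.side_inv \<epsilon> ?h1 ?g ?S A" and s2: "M2.side_inv \<epsilon> ?h2 ?g ?S A"
    and wA: "\<And>e. e \<in> A \<Longrightarrow> w e = ?h1 e + ?h2 e - ?g e"
    using inv unfolding run_inv_def by blast+
  have SA: "?S \<subseteq> A" "?S \<subseteq> E" using s1 by (auto simp: M1.side_inv_def)
  have finS: "finite ?S" using SA M1.finite_ground by (meson finite_subset)
  obtain T where T: "T \<in> \<I>1" "T \<in> \<I>2" "T \<subseteq> ?S"
    and ker: "\<And>e. e \<in> ?S \<Longrightarrow> M1.dominates ?h1 T {e} \<or> M2.dominates ?h2 T {e}"
    using matroid_kernel[OF M1.matroid_axioms M2.matroid_axioms SA(2)] by metis
  define D1 where "D1 = {e \<in> ?S. M1.dominates ?h1 T {e}}"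
  define D2 where "D2 = {e \<in> ?S. M2.dominates ?h2 T {e}}"
  have D: "finite D1" "finite D2" "?S = D1 \<union> D2" using finS ker by (auto simp: D1_def D2_def)
  \<comment> \<open>\<open>T\<close> dominates itself in both matroids, so the gain counted twice in
    \<open>D1\<close> and \<open>D2\<close> is at least that of \<open>T\<close>; this compensates
    for the subtracted \<open>sum ?g T\<close> in the weight of \<open>T\<close>.\<close>
  have TD: "T \<subseteq> D1 \<inter> D2"
    using T SA by (auto simp: D1_def D2_def intro!: M1.dominates_superset M2.dominates_superset)
  have "0 \<le> ?g e" if "e \<in> ?S" for e using that s1 SA by (force simp: M1.side_inv_def)
  then have "sum ?g T \<le> sum ?g (D1 \<inter> D2)"
    using D TD by (intro sum_mono2) auto
  moreover have "sum ?g ?S + sum ?g (D1 \<inter> D2) = sum ?g D1 + sum ?g D2"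
    unfolding D(3) using D(1,2) by (rule sum.union_inter)
  moreover have "sum ?g D1 \<le> sum ?h1 T" "sum ?g D2 \<le> sum ?h2 T"
    unfolding D1_def D2_def
    using M1.side_inv_dominated_le[OF s1 T(1,3)] M2.side_inv_dominated_le[OF s2 T(2,3)] by auto
  moreover have "sum w T = sum ?h1 T + sum ?h2 T - sum ?g T"
  proof -
    have "sum w T = (\<Sum>e\<in>T. ?h1 e + ?h2 e - ?g e)" using wA T(3) SA by (intro sum.cong) auto
    then show ?thesis by (simp add: sum.distrib sum_subtractf)
  qed
  ultimately have "sum ?g ?S \<le> sum w T" by linarith
  then show thesis using T that by blast
qed

text \<open>Each element of \<open>X\<close> is a non-loop and is charged to its two thresholds. In
  either matroid the thresholds on \<open>X\<close> sum to at most the total gain, hence the factor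
  2.\<close>

lemma run_inv_opt_le:
  assumes inv: "run_inv E A \<sigma>" and X: "X \<in> \<I>1" "X \<in> \<I>2"
  shows "sum w X \<le> 2 * (1 + \<epsilon>) * sum (gain \<sigma>) A"
proof -
  have s1: "M1.side_inv \<epsilon> (wt1 \<sigma>) (gain \<sigma>) (stored \<sigma>) A"
    and s2: "M2.side_inv \<epsilon> (wt2 \<sigma>) (gain \<sigma>) (stored \<sigma>) A"
    and thr: "\<And>e. e \<in> E \<Longrightarrow> e \<notin> M1.cl {} \<Longrightarrow> e \<notin> M2.cl {} \<Longrightarrow>
        \<exists>t1 t2. M1.threshold (wt1 \<sigma>) A e t1 \<and> M2.threshold (wt2 \<sigma>) A e t2 \<and>
           w e \<le> (1 + \<epsilon>) * (t1 + t2)"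
    using inv unfolding run_inv_def by blast+
  have "\<forall>e\<in>X. \<exists>t1 t2. M1.threshold (wt1 \<sigma>) A e t1 \<and> M2.threshold (wt2 \<sigma>) A e t2 \<and>
           w e \<le> (1 + \<epsilon>) * (t1 + t2)"
    using X M1.indep_not_loop M2.indep_not_loop M1.indep_subset_ground[OF X(1)] by (intro ballI thr) auto
  then obtain \<tau>1 \<tau>2 where \<tau>: "\<And>e. e \<in> X \<Longrightarrow> M1.threshold (wt1 \<sigma>) A e (\<tau>1 e)"
    "\<And>e. e \<in> X \<Longrightarrow> M2.threshold (wt2 \<sigma>) A e (\<tau>2 e)"
    "\<And>e. e \<in> X \<Longrightarrow> w e \<le> (1 + \<epsilon>) * (\<tau>1 e + \<tau>2 e)" by metis
  have "sum w X \<le> (\<Sum>e\<in>X. (1 + \<epsilon>) * (\<tau>1 e + \<tau>2 e))" using \<tau>(3) by (rule sum_mono)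
  also have "\<dots> = (1 + \<epsilon>) * (sum \<tau>1 X + sum \<tau>2 X)" by (simp add: sum_distrib_left[symmetric] sum.distrib)
  also have "\<dots> \<le> (1 + \<epsilon>) * (sum (gain \<sigma>) A + sum (gain \<sigma>) A)"
    using M1.side_inv_sum_threshold_le[OF s1 X(1) \<tau>(1)] M2.side_inv_sum_threshold_le[OF s2 X(2) \<tau>(2)]
      eps_pos by (intro mult_left_mono add_mono) auto
  finally show ?thesis by (simp add: algebra_simps)
qed

text \<open>For \<open>\<epsilon> < 1\<close> every removed element has weight at most \<open>\<epsilon> (1 + \<epsilon>) g\<^sub>m\<^sub>a\<^sub>x / r\<close> in the matroid
  of smaller rank \<open>r\<close>, so the removed elements have total gain at most \<open>\<epsilon> (1 + \<epsilon>) g\<^sub>m\<^sub>a\<^sub>x\<close>. For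
  larger \<open>\<epsilon>\<close> the element of maximal gain may itself be removed, but then the maximum-weight
  bases kept in \<open>S\<close> suffice.\<close>

lemma run_inv_total_gain_le:
  assumes inv: "run_inv D A \<sigma>" and y: "y = real (min (M1.rk E) (M2.rk E)) / \<epsilon>\<^sup>2"
  shows "sum (gain \<sigma>) A \<le> (1 + \<epsilon> + \<epsilon>\<^sup>2) * sum (gain \<sigma>) (stored \<sigma>)"
proof -
  let ?S = "stored \<sigma>" and ?g = "gain \<sigma>"
  have s1: "M1.side_inv \<epsilon> (wt1 \<sigma>) ?g ?S A" and s2: "M2.side_inv \<epsilon> (wt2 \<sigma>) ?g ?S A"
    and rem: "\<And>e. 1 \<le> y \<Longrightarrow> e \<in> A - ?S \<Longrightarrow> \<exists>m\<in>?S. y * ?g e \<le> ?g m"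
    using inv unfolding run_inv_def by blast+
  have A: "?S \<subseteq> A" "A \<subseteq> E" using s1 by (auto simp: M1.side_inv_def)
  have fin: "finite A" "finite ?S" using A M1.finite_ground by (auto intro: finite_subset)
  have g0: "0 \<le> ?g e" if "e \<in> A" for e using that s1 by (force simp: M1.side_inv_def)
  have G0: "0 \<le> sum ?g ?S" using g0 A by (intro sum_nonneg) auto
  show ?thesis
  proof (cases "1 \<le> \<epsilon>")
    case True
    then have "1 / \<epsilon> \<le> 1" by simp
    then have "1 + 1 / \<epsilon> \<le> 1 + \<epsilon> + \<epsilon>\<^sup>2" using True zero_le_power2[of \<epsilon>] by linarith
    then have "(1 + 1 / \<epsilon>) * sum ?g ?S \<le> (1 + \<epsilon> + \<epsilon>\<^sup>2) * sum ?g ?S"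
      using G0 by (rule mult_right_mono)
    then show ?thesis using M1.side_inv_total_le_stored[OF s1 eps_pos] by linarith
  next
    case False
    show ?thesis
    proof (cases "A = {}")
      case True
      then show ?thesis using A by simp
    next
      case False
      then obtain a where a: "a \<in> A" by auto
      \<comment> \<open>Kept elements are not loops, so a nonempty \<open>A\<close> makes both ranks
        at least 1, and with \<open>\<epsilon> < 1\<close> also \<open>y\<close>.\<close>
      then have "a \<in> E" "a \<notin> M1.cl {}" "a \<notin> M2.cl {}"
        using s1 s2 A by (auto simp: M1.side_inv_def M2.side_inv_def)
      then have "{a} \<in> \<I>1" "{a} \<in> \<I>2"
        using M1.insert_indep_iff M2.insert_indep_iff M1.indep_empty M2.indep_empty by auto
      then have "1 \<le> M1.rk E" "1 \<le> M2.rk E"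
        using M1.card_le_rk[of "{a}" E] M2.card_le_rk[of "{a}" E] \<open>a \<in> E\<close> by auto
      then have r1: "1 \<le> real (min (M1.rk E) (M2.rk E))" by simp
      define r where "r = real (min (M1.rk E) (M2.rk E))"
      have eps: "\<epsilon>\<^sup>2 \<le> 1" using \<open>\<not> 1 \<le> \<epsilon>\<close> eps_pos by (simp add: power_le_one)
      have "\<epsilon>\<^sup>2 \<le> real (min (M1.rk E) (M2.rk E))" using eps r1 by linarith
      then have y1: "1 \<le> y" using eps_pos unfolding y by (simp add: le_divide_eq)
      \<comment> \<open>\<open>sum ?g ?S / y\<close> bounds the gain of a removed element and
        \<open>c\<close> its two weights; the choice of \<open>y\<close> turns \<open>r * c\<close>
        into \<open>(\<epsilon> + \<epsilon>\<^sup>2) * sum ?g ?S\<close>.\<close>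
      define c where "c = (1 + 1 / \<epsilon>) * (sum ?g ?S / y)"
      have rc: "r * c = (\<epsilon> + \<epsilon>\<^sup>2) * sum ?g ?S"
        using r1 eps_pos unfolding c_def y r_def[symmetric]
        by (simp add: field_simps power2_eq_square)
      have c0: "0 \<le> c" using G0 y1 eps_pos by (simp add: c_def)
      have gc: "(1 + 1 / \<epsilon>) * ?g e \<le> c" if e: "e \<in> A - ?S" for e
      proof -
        obtain m where m: "m \<in> ?S" "y * ?g e \<le> ?g m" using rem[OF y1 e] by blast
        have "?g m \<le> sum ?g ?S" using m fin g0 A by (intro member_le_sum) auto
        then have "?g e \<le> sum ?g ?S / y" using m y1 by (simp add: le_divide_eq mult.commute)
        then show ?thesis unfolding c_def using eps_pos by (intro mult_left_mono) auto
      qed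
      have h: "wt1 \<sigma> e \<le> c" "wt2 \<sigma> e \<le> c" if "e \<in> A - ?S" for e
        using gc[OF that] that s1 s2 unfolding M1.side_inv_def M2.side_inv_def
        by (meson DiffD1 order_trans)+
      have "sum ?g (A - ?S) \<le> real (M1.rk E) * c"
        by (rule M1.side_inv_sum_le_card[OF s1 Diff_subset h(1) c0])
      moreover have "sum ?g (A - ?S) \<le> real (M2.rk E) * c"
        by (rule M2.side_inv_sum_le_card[OF s2 Diff_subset h(2) c0])
      ultimately have "sum ?g (A - ?S) \<le> r * c" by (simp add: r_def min_def)
      then show ?thesis
        using rc sum.subset_diff[OF A(1) fin(1), of ?g] by (simp add: algebra_simps)
    qed
  qed
qed

end

section \<open>The approximation ratio and its lower-order term\<close>

theorem theorem4p3:
  "\<exists>\<delta> :: real \<Rightarrow> real.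
     \<delta> \<in> o[at_right 0](\<lambda>\<epsilon>. \<epsilon>) \<and>
     (\<forall>\<epsilon>>0. 1 + 2 * \<epsilon> + \<delta> \<epsilon> > 0) \<and>
     (\<forall>(E :: 'a set) \<I>1 \<I>2 (w :: 'a \<Rightarrow> real) (es :: 'a list) (\<epsilon> :: real) \<sigma>.
        matroid E \<I>1 \<longrightarrow> matroid E \<I>2 \<longrightarrow>
        (\<forall>e\<in>E. w e \<ge> 0) \<longrightarrow>
        distinct es \<longrightarrow> set es = E \<longrightarrow>
        \<epsilon> > 0 \<longrightarrow>
        ss_result E \<I>1 \<I>2 w (1 + \<epsilon>) (real (min (mrank \<I>1 E) (mrank \<I>2 E)) / \<epsilon>\<^sup>2) es \<sigma> \<longrightarrow>
        (\<exists>T \<subseteq> stored \<sigma>.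
           T \<in> \<I>1 \<and> T \<in> \<I>2 \<and>
           sum w T \<ge> sum (gain \<sigma>) (stored \<sigma>) \<and>
           (\<forall>Sopt. is_arg_max (sum w) (\<lambda>X. X \<in> \<I>1 \<and> X \<in> \<I>2) Sopt \<longrightarrow>
              sum w T \<ge> sum w Sopt / (2 * (1 + 2 * \<epsilon> + \<delta> \<epsilon>)))))"
proof -
  \<comment> \<open>Chosen so that \<open>1 + 2 * \<epsilon> + \<delta> \<epsilon>\<close> is the
    product of the loss \<open>1 + \<epsilon>\<close> from discarding and the loss
    \<open>1 + \<epsilon> + \<epsilon>\<^sup>2\<close> from removals.\<close>
  define \<delta> :: "real \<Rightarrow> real" where "\<delta> \<epsilon> = 2 * \<epsilon>\<^sup>2 + \<epsilon> ^ 3" for \<epsilon>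
  have factor: "1 + 2 * \<epsilon> + \<delta> \<epsilon> = (1 + \<epsilon>) * (1 + \<epsilon> + \<epsilon>\<^sup>2)" for \<epsilon>
    by (simp add: \<delta>_def algebra_simps power2_eq_square power3_eq_cube)
  have pos: "1 + 2 * \<epsilon> + \<delta> \<epsilon> > 0" if "\<epsilon> > 0" for \<epsilon>
    using that by (simp add: \<delta>_def add_pos_pos)
  have small: "\<delta> \<in> o[at_right 0](\<lambda>\<epsilon>. \<epsilon>)"
  proof (rule smalloI_tendsto)
    have "((\<lambda>\<epsilon>. 2 * \<epsilon> + \<epsilon>\<^sup>2) \<longlongrightarrow> 2 * 0 + 0\<^sup>2) (at_right (0::real))"
      by (intro tendsto_intros)
    moreover have "eventually (\<lambda>\<epsilon>. 2 * \<epsilon> + \<epsilon>\<^sup>2 = \<delta> \<epsilon> / \<epsilon>) (at_right (0::real))"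
      using eventually_at_right_less[of "0::real"]
      by eventually_elim (simp add: \<delta>_def field_simps power2_eq_square power3_eq_cube)
    ultimately show "((\<lambda>\<epsilon>. \<delta> \<epsilon> / \<epsilon>) \<longlongrightarrow> 0) (at_right 0)"
      by (simp add: tendsto_cong)
    show "eventually (\<lambda>\<epsilon>. \<epsilon> \<noteq> 0) (at_right (0::real))"
      using eventually_at_right_less[of "0::real"] by eventually_elim simp
  qed
  have "\<exists>T \<subseteq> stored \<sigma>. T \<in> \<I>1 \<and> T \<in> \<I>2 \<and> sum w T \<ge> sum (gain \<sigma>) (stored \<sigma>) \<and>
      (\<forall>Sopt. is_arg_max (sum w) (\<lambda>X. X \<in> \<I>1 \<and> X \<in> \<I>2) Sopt \<longrightarrow>
        sum w T \<ge> sum w Sopt / (2 * (1 + 2 * \<epsilon> + \<delta> \<epsilon>)))"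
    if M: "matroid E \<I>1" "matroid E \<I>2" and es: "distinct es" "set es = E" and eps: "\<epsilon> > 0"
      and run: "ss_result E \<I>1 \<I>2 w (1 + \<epsilon>) (real (min (mrank \<I>1 E) (mrank \<I>2 E)) / \<epsilon>\<^sup>2) es \<sigma>"
    for E :: "'a set" and \<I>1 \<I>2 and w :: "'a \<Rightarrow> real" and es \<epsilon> \<sigma>
  proof -
    interpret matroid_pair E \<I>1 \<I>2 w \<epsilon> "real (min (mrank \<I>1 E) (mrank \<I>2 E)) / \<epsilon>\<^sup>2"
      using M eps by (intro matroid_pair.intro matroid_pair_axioms.intro)
    obtain A where inv: "run_inv E A \<sigma>"
      using run_inv_run[OF _ run_inv_init, of es \<sigma>] run es by (auto simp: ss_result_def)
    obtain T where T: "T \<in> \<I>1" "T \<in> \<I>2" "T \<subseteq> stored \<sigma>" "sum (gain \<sigma>) (stored \<sigma>) \<le> sum w T"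
      using run_inv_common_indep[OF inv] by blast
    have "sum w T \<ge> sum w X / (2 * (1 + 2 * \<epsilon> + \<delta> \<epsilon>))" if X: "X \<in> \<I>1" "X \<in> \<I>2" for X
    proof -
      have "sum w X \<le> 2 * (1 + \<epsilon>) * sum (gain \<sigma>) A" by (rule run_inv_opt_le[OF inv X])
      also have "\<dots> \<le> 2 * (1 + \<epsilon>) * ((1 + \<epsilon> + \<epsilon>\<^sup>2) * sum w T)"
      proof (rule mult_left_mono)
        have "(1 + \<epsilon> + \<epsilon>\<^sup>2) * sum (gain \<sigma>) (stored \<sigma>) \<le> (1 + \<epsilon> + \<epsilon>\<^sup>2) * sum w T"
          using T(4) eps by (intro mult_left_mono) auto
        then show "sum (gain \<sigma>) A \<le> (1 + \<epsilon> + \<epsilon>\<^sup>2) * sum w T"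
          using run_inv_total_gain_le[OF inv refl] by linarith
      qed (use eps in auto)
      also have "\<dots> = sum w T * (2 * (1 + 2 * \<epsilon> + \<delta> \<epsilon>))" by (simp add: factor)
      finally show ?thesis using pos[OF eps] by (simp add: pos_divide_le_eq)
    qed
    then show ?thesis using T by (auto simp: is_arg_max_def)
  qed
  then show ?thesis using small pos by (intro exI[of _ \<delta>]) blast
qed

end
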